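(* Let $\psi\in L^2(\mathbb{R})$, $\{a_j\}_{j\in\mathbb{Z}}\subset\mathbb{R}^+$, $\{c_m\}_{m\in\mathbb{Z}}\subset\mathbb{R}$, $b\neq 0$ real, and let $\Theta$ be a bounded linear operator on $L^2(\mathbb{R})$. Let $\{e_{j,k,m}\}_{j,k,m\in\mathbb{Z}}$ be an orthonormal basis of $\ell^2(\mathbb{Z}^3)$. Then $\{D_{a_j}T_{bk}E_{c_m}\psi\}_{j,k,m\in\mathbb{Z}}$ is a $\Theta$-$IWH$ wave packet frame for $L^2(\mathbb{R})$ if and only if there exists a bounded linear operator $\Xi:\ell^2(\mathbb{Z}^3)\to L^2(\mathbb{R})$ such that (i) the pair $(\Theta,\Xi)$ is relatively hyponormal, i.e. $\lambda\,\Theta^*\Theta\geq \Xi\,\Xi^*$ for some $\lambda>0$; and (ii) $\Xi(e_{j,k,m})=D_{a_j}T_{bk}E_{c_m}\psi$ for all $j,k,m\in\mathbb{Z}$, and $\mathcal{R}(\Theta)\subset\mathcal{R}(\Xi)$.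
   Context: For $f\in L^2(\mathbb{R})$: $T_af(t)=f(t-a)$ (translation, $a\in\mathbb{R}$), $E_bf(t)=e^{2\pi i bt}f(t)$ (modulation, $b\in\mathbb{R}$), $D_cf(t)=|c|^{1/2}f(ct)$ (dilation, $c\neq0$). $\mathcal{R}(T)$ denotes the range of an operator $T$. For bounded operators $T_1,T_2$ on a Hilbert space, $T_1\geq T_2$ means that $T_1-T_2$ is positive, i.e. $\langle (T_1-T_2)f,f\rangle\geq 0$ for all $f$. Definition. The system $\{D_{a_j}T_{bk}E_{c_m}\psi\}_{j,k,m\in\mathbb{Z}}$ is a $\Theta$-$IWH$ ($\Theta$-irregular Weyl-Heisenberg) wave packet frame for $L^2(\mathbb{R})$ if there exist constants $0<\alpha_0\leq\beta_0<\infty$ such that $$\alpha_0\|\Theta^*f\|^2\leq\sum_{j,k,m\in\mathbb{Z}}|\langle f,D_{a_j}T_{bk}E_{c_m}\psi\rangle|^2\leq\beta_0\|\Theta f\|^2\quad\text{for all } f\in L^2(\mathbb{R}).$$ *)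

theory Defs
  imports "HOL-Analysis.Analysis"
begin

section \<open>Complex inner product spaces\<close>

text \<open>The complex inner product is linear in its first argument. The real inner product space
  underlying the space has the real part of the complex inner product as its inner product;
  this fixes the norm \<open>norm x = sqrt (Re (cinner x x))\<close> and the topology.\<close>

class complex_inner = real_inner +
  fixes scaleC :: "complex \<Rightarrow> 'a \<Rightarrow> 'a" (infixr \<open>*\<^sub>C\<close> 75)
    and cinner :: "'a \<Rightarrow> 'a \<Rightarrow> complex"
  assumes scaleC_add_right: "z *\<^sub>C (x + y) = z *\<^sub>C x + z *\<^sub>C y"
    and scaleC_add_left: "(z + w) *\<^sub>C x = z *\<^sub>C x + w *\<^sub>C x"
    and scaleC_scaleC: "z *\<^sub>C w *\<^sub>C x = (z * w) *\<^sub>C x"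
    and scaleC_of_real: "complex_of_real r *\<^sub>C x = r *\<^sub>R x"
    and cinner_commute: "cinner x y = cnj (cinner y x)"
    and cinner_add_left: "cinner (x + y) u = cinner x u + cinner y u"
    and cinner_scaleC_left: "cinner (z *\<^sub>C x) y = z * cinner x y"
    and inner_eq_Re_cinner: "inner x y = Re (cinner x y)"

interpretation complex_vector: vector_space "scaleC :: complex \<Rightarrow> 'a \<Rightarrow> 'a::complex_inner"
proof
  fix x :: 'a
  show "1 *\<^sub>C x = x" using scaleC_of_real[of 1 x] by simp
qed (simp_all add: scaleC_add_right scaleC_add_left scaleC_scaleC)

definition bounded_clinear :: "('a::complex_inner \<Rightarrow> 'b::complex_inner) \<Rightarrow> bool" where
  "bounded_clinear T \<longleftrightarrow> Vector_Spaces.linear scaleC scaleC T \<and> bounded_linear T"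

text \<open>For bounded operators between Hilbert spaces the adjoint exists and is unique.\<close>

definition cadjoint :: "('a::complex_inner \<Rightarrow> 'b::complex_inner) \<Rightarrow> 'b \<Rightarrow> 'a" where
  "cadjoint T = (SOME S. \<forall>x y. cinner (T x) y = cinner x (S y))"

definition op_ge :: "('a::complex_inner \<Rightarrow> 'a) \<Rightarrow> ('a \<Rightarrow> 'a) \<Rightarrow> bool" where
  "op_ge S T \<longleftrightarrow> (\<forall>x. cinner (S x - T x) x \<in> \<real>\<^sub>\<ge>\<^sub>0)"

definition relatively_hyponormal ::
    "('a::complex_inner \<Rightarrow> 'b::complex_inner) \<Rightarrow> ('c::complex_inner \<Rightarrow> 'a) \<Rightarrow> bool" where
  "relatively_hyponormal T S \<longleftrightarrow>
     (\<exists>l>0. op_ge (\<lambda>x. l *\<^sub>R cadjoint T (T x)) (\<lambda>x. S (cadjoint S x)))"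

definition is_orthonormal_basis :: "('i \<Rightarrow> 'a::complex_inner) \<Rightarrow> bool" where
  "is_orthonormal_basis e \<longleftrightarrow>
     (\<forall>i j. cinner (e i) (e j) = (if i = j then 1 else 0)) \<and>
     closure (complex_vector.span (range e)) = UNIV"


section \<open>The sequence space of square-summable families\<close>

lemma mult_cnj_le_squares:
  "norm ((x::complex) * cnj y) \<le> (cmod x)\<^sup>2 + (cmod y)\<^sup>2"
proof -
  have "2 * (cmod x * cmod y) \<le> (cmod x)\<^sup>2 + (cmod y)\<^sup>2"
    using sum_squares_bound[of "cmod x" "cmod y"] by simp
  moreover have "0 \<le> cmod x * cmod y" by simp
  ultimately show ?thesis unfolding norm_mult complex_mod_cnj by linarith
qed

lemma Re_mult_cnj_self: "Re (z * cnj z) = (cmod z)\<^sup>2"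
  by (simp add: complex_mult_cnj cmod_power2)

lemma cmod_add_square_le: "(cmod (x + y))\<^sup>2 \<le> 2 * (cmod x)\<^sup>2 + 2 * (cmod y)\<^sup>2"
proof -
  have "(cmod (x + y))\<^sup>2 \<le> (cmod x + cmod y)\<^sup>2"
    by (intro power_mono norm_triangle_ineq) simp
  also have "\<dots> \<le> 2 * (cmod x)\<^sup>2 + 2 * (cmod y)\<^sup>2"
    using sum_squares_bound[of "cmod x" "cmod y"] by (simp add: power2_sum)
  finally show ?thesis .
qed

typedef 'i ell2 = "{f :: 'i \<Rightarrow> complex. (\<lambda>i. (cmod (f i))\<^sup>2) summable_on UNIV}"
  by (rule exI[of _ "\<lambda>_. 0"]) simp

setup_lifting type_definition_ell2

lemma ell2_summable_mult_cnj:
  fixes f g :: "'i \<Rightarrow> complex"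
  assumes "(\<lambda>i. (cmod (f i))\<^sup>2) summable_on UNIV" "(\<lambda>i. (cmod (g i))\<^sup>2) summable_on UNIV"
  shows "(\<lambda>i. f i * cnj (g i)) summable_on UNIV"
  by (rule abs_summable_summable,
      rule Infinite_Sum.abs_summable_on_comparison_test'[OF summable_on_add[OF assms]],
      rule mult_cnj_le_squares)

lemma ell2_summable_add:
  fixes f g :: "'i \<Rightarrow> complex"
  assumes "(\<lambda>i. (cmod (f i))\<^sup>2) summable_on UNIV" "(\<lambda>i. (cmod (g i))\<^sup>2) summable_on UNIV"
  shows "(\<lambda>i. (cmod (f i + g i))\<^sup>2) summable_on UNIV"
proof -
  have "(\<lambda>i. 2 * (cmod (f i))\<^sup>2 + 2 * (cmod (g i))\<^sup>2) summable_on UNIV"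
    by (intro summable_on_add summable_on_cmult_right assms)
  from Infinite_Sum.abs_summable_on_comparison_test'[OF this, of "\<lambda>i. (cmod (f i + g i))\<^sup>2"] show ?thesis
    by (simp add: cmod_add_square_le)
qed

lemma ell2_summable_scale:
  fixes f :: "'i \<Rightarrow> complex"
  assumes "(\<lambda>i. (cmod (f i))\<^sup>2) summable_on UNIV"
  shows "(\<lambda>i. (cmod (z * f i))\<^sup>2) summable_on UNIV"
  using summable_on_cmult_right[OF assms, of "(cmod z)\<^sup>2"]
  by (simp add: norm_mult power_mult_distrib)

instantiation ell2 :: (type) complex_inner
begin

lift_definition zero_ell2 :: "'a ell2" is "\<lambda>_. 0" by simp
lift_definition plus_ell2 :: "'a ell2 \<Rightarrow> 'a ell2 \<Rightarrow> 'a ell2" is "\<lambda>f g i. f i + g i"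
  by (rule ell2_summable_add)
lift_definition scaleC_ell2 :: "complex \<Rightarrow> 'a ell2 \<Rightarrow> 'a ell2" is "\<lambda>z f i. z * f i"
  by (rule ell2_summable_scale)
lift_definition cinner_ell2 :: "'a ell2 \<Rightarrow> 'a ell2 \<Rightarrow> complex" is
  "\<lambda>f g. \<Sum>\<^sub>\<infinity>i. f i * cnj (g i)" .

definition uminus_ell2 :: "'a ell2 \<Rightarrow> 'a ell2" where "uminus_ell2 x = (- 1) *\<^sub>C x"
definition minus_ell2 :: "'a ell2 \<Rightarrow> 'a ell2 \<Rightarrow> 'a ell2" where "minus_ell2 x y = x + (- y)"
definition scaleR_ell2 :: "real \<Rightarrow> 'a ell2 \<Rightarrow> 'a ell2" where
  "scaleR_ell2 r x = complex_of_real r *\<^sub>C x"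
definition inner_ell2 :: "'a ell2 \<Rightarrow> 'a ell2 \<Rightarrow> real" where "inner_ell2 x y = Re (cinner x y)"
definition norm_ell2 :: "'a ell2 \<Rightarrow> real" where "norm_ell2 x = sqrt (inner x x)"
definition sgn_ell2 :: "'a ell2 \<Rightarrow> 'a ell2" where "sgn_ell2 x = inverse (norm x) *\<^sub>R x"
definition dist_ell2 :: "'a ell2 \<Rightarrow> 'a ell2 \<Rightarrow> real" where "dist_ell2 x y = norm (x - y)"
definition uniformity_ell2 :: "('a ell2 \<times> 'a ell2) filter" where
  "uniformity_ell2 = (INF e\<in>{0<..}. principal {(x, y). dist x y < e})"
definition open_ell2 :: "'a ell2 set \<Rightarrow> bool" where
  "open_ell2 U \<longleftrightarrow> (\<forall>x\<in>U. eventually (\<lambda>(x', y). x' = x \<longrightarrow> y \<in> U) uniformity)"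

instance
proof
  fix x y u :: "'a ell2" and r s :: real and z w :: complex and U :: "'a ell2 set"
  show "x + y + u = x + (y + u)" by transfer (simp add: add.assoc)
  show "x + y = y + x" by transfer (simp add: add.commute)
  show "0 + x = x" by transfer simp
  show "- x + x = 0" unfolding uminus_ell2_def by transfer simp
  show "x - y = x + - y" by (simp add: minus_ell2_def)
  show sCr: "z *\<^sub>C (x + y) = z *\<^sub>C x + z *\<^sub>C y" for z and x y :: "'a ell2"
    by transfer (simp add: algebra_simps)
  show sCl: "(z + w) *\<^sub>C x = z *\<^sub>C x + w *\<^sub>C x" for z w and x :: "'a ell2"
    by transfer (simp add: algebra_simps)
  show sCC: "z *\<^sub>C w *\<^sub>C x = (z * w) *\<^sub>C x" for z w and x :: "'a ell2"
    by transfer (simp add: algebra_simps)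
  show "complex_of_real r *\<^sub>C x = r *\<^sub>R x" by (simp add: scaleR_ell2_def)
  show "r *\<^sub>R (x + y) = r *\<^sub>R x + r *\<^sub>R y" by (simp add: scaleR_ell2_def sCr)
  show "(r + s) *\<^sub>R x = r *\<^sub>R x + s *\<^sub>R x" by (simp add: scaleR_ell2_def sCl)
  show "r *\<^sub>R s *\<^sub>R x = (r * s) *\<^sub>R x" by (simp add: scaleR_ell2_def sCC)
  show "1 *\<^sub>R x = x" unfolding scaleR_ell2_def by transfer simp
  show cc: "cinner x y = cnj (cinner y x)" for x y :: "'a ell2"
    by transfer (simp flip: infsum_cnj add: mult.commute)
  show ca: "cinner (x + y) u = cinner x u + cinner y u"
    by transfer (simp add: distrib_right infsum_add ell2_summable_mult_cnj)
  show cs: "cinner (z *\<^sub>C x) y = z * cinner x y" for z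
    by transfer (simp add: mult.assoc infsum_cmult_right')
  show "inner x y = Re (cinner x y)" by (simp add: inner_ell2_def)
  show "inner x y = inner y x" by (simp add: inner_ell2_def cc[of x y])
  show "inner (x + y) u = inner x u + inner y u" by (simp add: inner_ell2_def ca)
  show "inner (r *\<^sub>R x) y = r * inner x y" by (simp add: inner_ell2_def scaleR_ell2_def cs)
  have Re_cinner: "inner x x = (\<Sum>\<^sub>\<infinity>i. (cmod (Rep_ell2 x i))\<^sup>2)"
    unfolding inner_ell2_def
    by transfer (simp only: mem_Collect_eq Re_mult_cnj_self ell2_summable_mult_cnj infsum_Re[symmetric])
  show "0 \<le> inner x x" unfolding Re_cinner by (rule infsum_nonneg) simp
  show "inner x x = 0 \<longleftrightarrow> x = 0"
  proof
    assume "inner x x = 0"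
    then have "(\<Sum>\<^sub>\<infinity>i. (cmod (Rep_ell2 x i))\<^sup>2) \<le> 0" unfolding Re_cinner by simp
    moreover have "(\<lambda>i. (cmod (Rep_ell2 x i))\<^sup>2) summable_on UNIV" using Rep_ell2[of x] by simp
    ultimately have "(cmod (Rep_ell2 x i))\<^sup>2 = 0" for i by (rule nonneg_infsum_le_0D) auto
    then show "x = 0" by (simp add: Rep_ell2_inject[symmetric] zero_ell2.rep_eq fun_eq_iff)
  next
    assume "x = 0"
    then show "inner x x = 0" unfolding Re_cinner by (simp add: zero_ell2.rep_eq)
  qed
  show "norm x = sqrt (inner x x)" by (simp add: norm_ell2_def)
  show "sgn x = inverse (norm x) *\<^sub>R x" by (simp add: sgn_ell2_def)
  show "dist x y = norm (x - y)" by (simp add: dist_ell2_def)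
  show "(uniformity :: ('a ell2 \<times> 'a ell2) filter) = (INF e\<in>{0<..}. principal {(x, y). dist x y < e})"
    by (simp add: uniformity_ell2_def)
  show "open U \<longleftrightarrow> (\<forall>x\<in>U. eventually (\<lambda>(x', y). x' = x \<longrightarrow> y \<in> U) uniformity)"
    by (simp add: open_ell2_def)
qed

end


section \<open>The space of square-integrable functions on the real line\<close>

text \<open>Borel representatives suffice: every Lebesgue measurable function agrees almost everywhere
  with a Borel measurable one.\<close>

definition square_integrable :: "(real \<Rightarrow> complex) \<Rightarrow> bool" where
  "square_integrable f \<longleftrightarrow>
     f \<in> borel_measurable lborel \<and> integrable lborel (\<lambda>t. (cmod (f t))\<^sup>2)"

definition L2_rel :: "(real \<Rightarrow> complex) \<Rightarrow> (real \<Rightarrow> complex) \<Rightarrow> bool" where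
  "L2_rel f g \<longleftrightarrow> square_integrable f \<and> square_integrable g \<and> (AE t in lborel. f t = g t)"

lemma borel_measurable_cnj [measurable]: "cnj \<in> borel_measurable borel"
  by (intro borel_measurable_continuous_onI continuous_intros)

lemma square_integrable_measurable [measurable_dest]:
  "square_integrable f \<Longrightarrow> f \<in> borel_measurable borel"
  by (simp add: square_integrable_def)

lemma square_integrable_mult_cnj:
  assumes "square_integrable f" "square_integrable g"
  shows "integrable lborel (\<lambda>t. f t * cnj (g t))"
proof (rule Bochner_Integration.integrable_bound)
  show "integrable lborel (\<lambda>t. (cmod (f t))\<^sup>2 + (cmod (g t))\<^sup>2)"
    using assms by (auto simp: square_integrable_def)
  note [measurable] = assms[THEN square_integrable_measurable]
  show "(\<lambda>t. f t * cnj (g t)) \<in> borel_measurable lborel" by measurable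
  show "AE t in lborel. norm (f t * cnj (g t)) \<le> norm ((cmod (f t))\<^sup>2 + (cmod (g t))\<^sup>2)"
    by (intro AE_I2 order_trans[OF mult_cnj_le_squares]) simp
qed

lemma square_integrable_add:
  assumes "square_integrable f" "square_integrable g"
  shows "square_integrable (\<lambda>t. f t + g t)"
proof -
  note [measurable] = assms[THEN square_integrable_measurable]
  have "integrable lborel (\<lambda>t. (cmod (f t + g t))\<^sup>2)"
  proof (rule Bochner_Integration.integrable_bound)
    show "integrable lborel (\<lambda>t. 2 * (cmod (f t))\<^sup>2 + 2 * (cmod (g t))\<^sup>2)"
      using assms by (auto simp: square_integrable_def)
    show "AE t in lborel. norm ((cmod (f t + g t))\<^sup>2)
        \<le> norm (2 * (cmod (f t))\<^sup>2 + 2 * (cmod (g t))\<^sup>2)"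
      using cmod_add_square_le by (intro AE_I2) simp
  qed measurable
  then show ?thesis by (simp add: square_integrable_def)
qed

lemma square_integrable_mult:
  assumes "square_integrable f" and [measurable]: "h \<in> borel_measurable borel"
    and bound: "\<And>t. cmod (h t) \<le> B"
  shows "square_integrable (\<lambda>t. h t * f t)"
proof -
  note [measurable] = assms(1)[THEN square_integrable_measurable]
  have "integrable lborel (\<lambda>t. (cmod (h t * f t))\<^sup>2)"
  proof (rule Bochner_Integration.integrable_bound)
    show "integrable lborel (\<lambda>t. B\<^sup>2 * (cmod (f t))\<^sup>2)"
      using assms by (auto simp: square_integrable_def)
    show "AE t in lborel. norm ((cmod (h t * f t))\<^sup>2) \<le> norm (B\<^sup>2 * (cmod (f t))\<^sup>2)"
      using bound
      by (intro AE_I2) (auto simp: norm_mult power_mult_distrib intro!: mult_right_mono power_mono)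
  qed measurable
  then show ?thesis by (simp add: square_integrable_def)
qed

lemma square_integrable_affine:
  assumes "square_integrable f" "c \<noteq> 0"
  shows "square_integrable (\<lambda>t. f (d + c * t))"
proof -
  note [measurable] = assms(1)[THEN square_integrable_measurable]
  show ?thesis
    using lborel_integrable_real_affine[OF _ assms(2), of "\<lambda>t. (cmod (f t))\<^sup>2" d] assms(1)
    by (simp add: square_integrable_def)
qed

lemma L2_rel_affine:
  assumes "L2_rel f g" "c \<noteq> 0"
  shows "L2_rel (\<lambda>t. f (d + c * t)) (\<lambda>t. g (d + c * t))"
proof -
  have [measurable]: "f \<in> borel_measurable borel" "g \<in> borel_measurable borel"
    using assms(1) by (auto simp: L2_rel_def dest: square_integrable_measurable)
  have "AE t in lborel. f (d + c * t) = g (d + c * t)"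
    using assms by (intro AE_borel_affine[where P = "\<lambda>t. f t = g t"]) (auto simp: L2_rel_def)
  then show ?thesis using assms by (auto simp: L2_rel_def square_integrable_affine)
qed

lemma L2_rel_mult:
  assumes "L2_rel f g" "h \<in> borel_measurable borel" "\<And>t. cmod (h t) \<le> B"
  shows "L2_rel (\<lambda>t. h t * f t) (\<lambda>t. h t * g t)"
  using assms by (auto simp: L2_rel_def intro: square_integrable_mult)

lemma L2_rel_zero: "L2_rel (\<lambda>_. 0) (\<lambda>_. 0)"
  by (simp add: L2_rel_def square_integrable_def)

quotient_type L2 = "real \<Rightarrow> complex" / partial: L2_rel
proof (rule part_equivpI)
  show "\<exists>f. L2_rel f f" using L2_rel_zero by blast
  show "symp L2_rel" by (auto simp: symp_def L2_rel_def)
  show "transp L2_rel" unfolding transp_def L2_rel_def by fastforce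
qed

instantiation L2 :: complex_inner
begin

lift_definition zero_L2 :: L2 is "\<lambda>_. 0" by (rule L2_rel_zero)
lift_definition plus_L2 :: "L2 \<Rightarrow> L2 \<Rightarrow> L2" is "\<lambda>f g t. f t + g t"
  by (auto simp: L2_rel_def square_integrable_add)
lift_definition scaleC_L2 :: "complex \<Rightarrow> L2 \<Rightarrow> L2" is "\<lambda>z f t. z * f t"
  subgoal for z f g by (rule L2_rel_mult[where B = "cmod z"]) auto
  done
lift_definition cinner_L2 :: "L2 \<Rightarrow> L2 \<Rightarrow> complex" is
  "\<lambda>f g. \<integral>t. f t * cnj (g t) \<partial>lborel"
  by (rule integral_cong_AE) (auto simp: L2_rel_def square_integrable_def)

definition uminus_L2 :: "L2 \<Rightarrow> L2" where "uminus_L2 x = (- 1) *\<^sub>C x"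
definition minus_L2 :: "L2 \<Rightarrow> L2 \<Rightarrow> L2" where "minus_L2 x y = x + (- y)"
definition scaleR_L2 :: "real \<Rightarrow> L2 \<Rightarrow> L2" where "scaleR_L2 r x = complex_of_real r *\<^sub>C x"
definition inner_L2 :: "L2 \<Rightarrow> L2 \<Rightarrow> real" where "inner_L2 x y = Re (cinner x y)"
definition norm_L2 :: "L2 \<Rightarrow> real" where "norm_L2 x = sqrt (inner x x)"
definition sgn_L2 :: "L2 \<Rightarrow> L2" where "sgn_L2 x = inverse (norm x) *\<^sub>R x"
definition dist_L2 :: "L2 \<Rightarrow> L2 \<Rightarrow> real" where "dist_L2 x y = norm (x - y)"
definition uniformity_L2 :: "(L2 \<times> L2) filter" where
  "uniformity_L2 = (INF e\<in>{0<..}. principal {(x, y). dist x y < e})"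
definition open_L2 :: "L2 set \<Rightarrow> bool" where
  "open_L2 U \<longleftrightarrow> (\<forall>x\<in>U. eventually (\<lambda>(x', y). x' = x \<longrightarrow> y \<in> U) uniformity)"

instance
proof
  fix x y u :: L2 and r s :: real and z w :: complex and U :: "L2 set"
  show "x + y + u = x + (y + u)"
    by transfer (auto simp: L2_rel_def square_integrable_add add.assoc)
  show "x + y = y + x"
    by transfer (auto simp: L2_rel_def square_integrable_add add.commute)
  show "0 + x = x" by transfer (auto simp: L2_rel_def)
  show "- x + x = 0" unfolding uminus_L2_def
    by transfer (auto simp: L2_rel_def square_integrable_def)
  show "x - y = x + - y" by (simp add: minus_L2_def)
  have scale: "square_integrable (\<lambda>t. z * f t)" if "square_integrable f" for z f
    using that by (rule square_integrable_mult[where B = "cmod z"]) auto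
  show sCr: "z *\<^sub>C (x + y) = z *\<^sub>C x + z *\<^sub>C y" for z and x y :: L2
    by transfer (auto simp: L2_rel_def algebra_simps intro!: square_integrable_add scale)
  show sCl: "(z + w) *\<^sub>C x = z *\<^sub>C x + w *\<^sub>C x" for z w and x :: L2
    by transfer (auto simp: L2_rel_def distrib_right intro!: square_integrable_add scale)
  show sCC: "z *\<^sub>C w *\<^sub>C x = (z * w) *\<^sub>C x" for z w and x :: L2
    by transfer (auto simp: L2_rel_def mult.assoc intro!: scale)
  show "complex_of_real r *\<^sub>C x = r *\<^sub>R x" by (simp add: scaleR_L2_def)
  show "r *\<^sub>R (x + y) = r *\<^sub>R x + r *\<^sub>R y" by (simp add: scaleR_L2_def sCr)
  show "(r + s) *\<^sub>R x = r *\<^sub>R x + s *\<^sub>R x" by (simp add: scaleR_L2_def sCl)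
  show "r *\<^sub>R s *\<^sub>R x = (r * s) *\<^sub>R x" by (simp add: scaleR_L2_def sCC)
  show "1 *\<^sub>R x = x" unfolding scaleR_L2_def by transfer (auto simp: L2_rel_def)
  show cc: "cinner x y = cnj (cinner y x)" for x y :: L2
    by transfer (simp flip: Bochner_Integration.integral_cnj add: mult.commute)
  show ca: "cinner (x + y) u = cinner x u + cinner y u"
    by transfer (simp add: L2_rel_def distrib_right square_integrable_mult_cnj)
  show cs: "cinner (z *\<^sub>C x) y = z * cinner x y" for z
    by transfer (simp add: mult.assoc)
  show "inner x y = Re (cinner x y)" by (simp add: inner_L2_def)
  show "inner x y = inner y x" by (simp add: inner_L2_def cc[of x y])
  show "inner (x + y) u = inner x u + inner y u" by (simp add: inner_L2_def ca)
  show "inner (r *\<^sub>R x) y = r * inner x y" by (simp add: inner_L2_def scaleR_L2_def cs)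
  have Re_eq: "Re (\<integral>t. f t * cnj (f t) \<partial>lborel) = (\<integral>t. (cmod (f t))\<^sup>2 \<partial>lborel)"
    if "square_integrable f" for f
    using that
    by (simp only: square_integrable_mult_cnj Re_mult_cnj_self integral_Re[symmetric])
  show "0 \<le> inner x x" unfolding inner_L2_def by transfer (simp add: L2_rel_def Re_eq)
  show "inner x x = 0 \<longleftrightarrow> x = 0"
    unfolding inner_L2_def
  proof transfer
    fix f assume "L2_rel f f"
    then have f: "square_integrable f" by (simp add: L2_rel_def)
    then have "(\<integral>t. (cmod (f t))\<^sup>2 \<partial>lborel) = 0 \<longleftrightarrow> (AE t in lborel. (cmod (f t))\<^sup>2 = 0)"
      by (intro integral_nonneg_eq_0_iff_AE) (auto simp: square_integrable_def)
    with f L2_rel_zero show "Re (\<integral>t. f t * cnj (f t) \<partial>lborel) = 0 \<longleftrightarrow> L2_rel f (\<lambda>_. 0)"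
      by (simp add: Re_eq L2_rel_def)
  qed
  show "norm x = sqrt (inner x x)" by (simp add: norm_L2_def)
  show "sgn x = inverse (norm x) *\<^sub>R x" by (simp add: sgn_L2_def)
  show "dist x y = norm (x - y)" by (simp add: dist_L2_def)
  show "(uniformity :: (L2 \<times> L2) filter) = (INF e\<in>{0<..}. principal {(x, y). dist x y < e})"
    by (simp add: uniformity_L2_def)
  show "open U \<longleftrightarrow> (\<forall>x\<in>U. eventually (\<lambda>(x', y). x' = x \<longrightarrow> y \<in> U) uniformity)"
    by (simp add: open_L2_def)
qed

end


section \<open>Wave packet systems\<close>

lift_definition translation :: "real \<Rightarrow> L2 \<Rightarrow> L2" is "\<lambda>a f t. f (t - a)"
  subgoal for a f g using L2_rel_affine[of f g 1 "- a"] by (simp add: algebra_simps)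
  done

lift_definition modulation :: "real \<Rightarrow> L2 \<Rightarrow> L2" is
  "\<lambda>b f t. exp (2 * complex_of_real pi * \<i> * complex_of_real (b * t)) * f t"
  by (rule L2_rel_mult[where B = 1]) auto

text \<open>Only \<open>c \<noteq> 0\<close> is meaningful; \<open>c = 0\<close> yields the zero function.\<close>

lift_definition dilation :: "real \<Rightarrow> L2 \<Rightarrow> L2" is
  "\<lambda>c f t. complex_of_real (sqrt \<bar>c\<bar>) * f (c * t)"
  subgoal for c f g
  proof (cases "c = 0")
    case False
    assume "L2_rel f g"
    from L2_rel_affine[OF this False, of 0] show ?thesis
      by (intro L2_rel_mult[where B = "sqrt \<bar>c\<bar>"]) auto
  qed (simp add: L2_rel_zero)
  done

definition wave_packet ::
    "(int \<Rightarrow> real) \<Rightarrow> real \<Rightarrow> (int \<Rightarrow> real) \<Rightarrow> L2 \<Rightarrow> int \<times> int \<times> int \<Rightarrow> L2" where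
  "wave_packet a b c \<psi> =
     (\<lambda>(j, k, m). dilation (a j) (translation (b * of_int k) (modulation (c m) \<psi>)))"

text \<open>Summability is required explicitly, because \<^const>\<open>infsum\<close> is 0 on divergent families.\<close>

definition Theta_IWH_frame ::
    "(L2 \<Rightarrow> L2) \<Rightarrow> (int \<Rightarrow> real) \<Rightarrow> real \<Rightarrow> (int \<Rightarrow> real) \<Rightarrow> L2 \<Rightarrow> bool" where
  "Theta_IWH_frame \<Theta> a b c \<psi> \<longleftrightarrow>
     (\<exists>\<alpha> \<beta>. 0 < \<alpha> \<and> \<alpha> \<le> \<beta> \<and>
       (\<forall>f. (\<lambda>p. (cmod (cinner f (wave_packet a b c \<psi> p)))\<^sup>2) summable_on UNIV \<and>
            \<alpha> * (norm (cadjoint \<Theta> f))\<^sup>2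
              \<le> (\<Sum>\<^sub>\<infinity>p. (cmod (cinner f (wave_packet a b c \<psi> p)))\<^sup>2) \<and>
            (\<Sum>\<^sub>\<infinity>p. (cmod (cinner f (wave_packet a b c \<psi> p)))\<^sup>2) \<le> \<beta> * (norm (\<Theta> f))\<^sup>2))"

end

theory Submission
  imports Defs
begin

text \<open>Write \<open>g\<close> for the wave packet system. The equivalence is a statement about families in a
  Hilbert space (\<open>Theta_frame_iff_synthesis_operator\<close>) and rests on the identity
  \<open>(\<Sum>\<^sub>\<infinity>i. (cmod (cinner f (g i)))\<^sup>2) = (norm (cadjoint \<Xi> f))\<^sup>2\<close>, valid for every bounded \<open>\<Xi>\<close> that sends
  the basis vector \<open>e i\<close> to \<open>g i\<close> (\<open>frame_sum_eq_norm_cadjoint\<close>), which is Parseval's identity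
  for \<open>cadjoint \<Xi> f\<close>. Under it the upper frame bound says that
  \<open>(norm (cadjoint \<Xi> f))\<^sup>2 \<le> \<beta> * (norm (\<Theta> f))\<^sup>2\<close>, which is relative hyponormality. The lower frame
  bound says that \<open>norm (cadjoint \<Theta> f)\<close> is at most a constant times \<open>norm (cadjoint \<Xi> f)\<close>, which by
  Douglas' theorem (\<open>douglas_range_inclusion\<close>) means that the range of \<open>\<Theta>\<close> lies in that of \<open>\<Xi>\<close>.

  It remains to produce \<open>\<Xi>\<close> from a frame. The upper bound and the boundedness of \<open>\<Theta>\<close> make \<open>g\<close> a
  Bessel family, so its analysis operator is bounded and has an adjoint, from which
  \<open>synthesis_operator\<close> builds \<open>\<Xi>\<close>.

  The functional analysis behind this comes down to completeness of the two concrete spaces, a Riesz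
  representation lemma (\<open>riesz_along_linear_map\<close>) that yields both the existence of adjoints and one
  half of Douglas' theorem, and the Banach-Steinhaus theorem for the other half.\<close>

section \<open>Riesz representation, uniform boundedness and range inclusion\<close>

text \<open>Minimise the energy \<open>norm (A f)\<^sup>2 / 2 - \<phi> f\<close>. The bound keeps it bounded below, and the
  parallelogram law makes the images under \<open>A\<close> of a minimising sequence Cauchy; the vanishing first
  variation at their limit \<open>y\<close> is the claim. The minimising sequence itself need not converge, so only
  the codomain of \<open>A\<close> has to be complete. For \<open>A\<close> the identity this is the Riesz representation
  theorem, and for \<open>A\<close> an adjoint it solves operator equations.\<close>

lemma riesz_along_linear_map:
  fixes A :: "'a::real_vector \<Rightarrow> 'b::{real_inner, complete_space}" and \<phi> :: "'a \<Rightarrow> real"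
  assumes A: "linear A" and \<phi>: "linear \<phi>" and bound: "\<And>f. \<bar>\<phi> f\<bar> \<le> C * norm (A f)"
  shows "\<exists>y. \<forall>f. \<phi> f = inner (A f) y"
proof -
  define J where "J f = (norm (A f))\<^sup>2 / 2 - \<phi> f" for f
  define m where "m = (INF f. J f)"
  have J_lower: "- (C\<^sup>2 / 2) \<le> J f" for f
  proof -
    have "0 \<le> (norm (A f) - C)\<^sup>2" by simp
    then show ?thesis
      using bound[of f] by (simp add: J_def power2_diff abs_le_iff mult.commute)
  qed
  then have bdd: "bdd_below (range J)"
    by (meson bdd_belowI2)
  have m_le: "m \<le> J f" for f
    unfolding m_def by (rule cINF_lower[OF bdd]) simp
  have "\<exists>f. J f < m + 1 / real (Suc n)" for n
    using cINF_less_iff[OF _ bdd, of "m + 1 / real (Suc n)"] by (auto simp: m_def[symmetric])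
  then obtain f where f: "\<And>n. J (f n) < m + 1 / real (Suc n)" by metis
  \<comment> \<open>the parallelogram law, read as uniform convexity of \<open>J\<close> along \<open>A\<close>\<close>
  have half: "J g + J h - 2 * J ((1/2) *\<^sub>R (g + h)) = (norm (A g - A h))\<^sup>2 / 4" for g h
    by (simp add: J_def linear_cmul[OF A] linear_add[OF A] linear_cmul[OF \<phi>] linear_add[OF \<phi>]
        power2_norm_eq_inner inner_add inner_diff inner_commute power_mult_distrib field_simps)
  have close: "(norm (A g - A h))\<^sup>2 \<le> 4 * ((J g - m) + (J h - m))" for g h
    using half[of g h] m_le[of "(1/2) *\<^sub>R (g + h)"] by simp
  have "Cauchy (\<lambda>n. A (f n))"
  proof (rule CauchyI)
    fix \<epsilon> :: real assume "0 < \<epsilon>"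
    then obtain N where N: "1 / real (Suc N) < \<epsilon>\<^sup>2 / 8"
      using nat_approx_posE[of "\<epsilon>\<^sup>2 / 8"] by (auto simp: inverse_eq_divide)
    have small: "J (f n) - m < \<epsilon>\<^sup>2 / 8" if "n \<ge> N" for n
    proof -
      have "1 / real (Suc n) \<le> 1 / real (Suc N)"
        using that by (intro divide_left_mono) auto
      then show ?thesis using f[of n] N by linarith
    qed
    have "norm (A (f i) - A (f j)) < \<epsilon>" if "i \<ge> N" "j \<ge> N" for i j
    proof (rule power2_less_imp_less)
      show "(norm (A (f i) - A (f j)))\<^sup>2 < \<epsilon>\<^sup>2"
      proof (rule le_less_trans[OF close])
        show "4 * ((J (f i) - m) + (J (f j) - m)) < \<epsilon>\<^sup>2"
          using small[OF that(1)] small[OF that(2)] by simp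
      qed
    qed (use \<open>0 < \<epsilon>\<close> in simp)
    then show "\<exists>M. \<forall>i\<ge>M. \<forall>j\<ge>M. norm (A (f i) - A (f j)) < \<epsilon>" by blast
  qed
  then obtain y where y: "(\<lambda>n. A (f n)) \<longlonglongrightarrow> y"
    using Cauchy_convergent convergent_def by blast
  have J_lim: "(\<lambda>n. J (f n)) \<longlonglongrightarrow> m"
  proof (rule tendsto_sandwich[where f = "\<lambda>_. m" and h = "\<lambda>n. m + 1 / real (Suc n)"])
    show "(\<lambda>n. m + 1 / real (Suc n)) \<longlonglongrightarrow> m"
      using tendsto_add[OF tendsto_const LIMSEQ_Suc[OF lim_1_over_n], of m] by simp
    show "\<forall>\<^sub>F n in sequentially. J (f n) \<le> m + 1 / real (Suc n)"
      by (intro always_eventually allI less_imp_le f)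
  qed (simp_all add: m_le)
  have "\<phi> h = inner (A h) y" for h
  proof -
    define D where "D = inner y (A h) - \<phi> h"
    define K where "K = (norm (A h))\<^sup>2"
    have "0 \<le> K" by (simp add: K_def)
    have quadratic: "0 \<le> t * D + t\<^sup>2 * K / 2" for t
    proof -
      have "J (f n + t *\<^sub>R h) = J (f n) + t * (inner (A (f n)) (A h) - \<phi> h) + t\<^sup>2 * K / 2" for n
        by (simp add: J_def K_def linear_cmul[OF A] linear_add[OF A] linear_cmul[OF \<phi>] linear_add[OF \<phi>]
            power2_norm_eq_inner inner_add inner_commute power2_eq_square[of t] field_simps)
      then have "m \<le> J (f n) + t * (inner (A (f n)) (A h) - \<phi> h) + t\<^sup>2 * K / 2" for n
        using m_le[of "f n + t *\<^sub>R h"] by simp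
      moreover have "(\<lambda>n. J (f n) + t * (inner (A (f n)) (A h) - \<phi> h) + t\<^sup>2 * K / 2)
          \<longlonglongrightarrow> m + t * (inner y (A h) - \<phi> h) + t\<^sup>2 * K / 2"
        by (intro tendsto_intros J_lim y)
      ultimately have "m \<le> m + t * (inner y (A h) - \<phi> h) + t\<^sup>2 * K / 2"
        by (intro LIMSEQ_le_const) auto
      then show ?thesis by (simp add: D_def)
    qed
    \<comment> \<open>the parabola has its vertex near \<open>- D / K\<close>; the denominator \<open>K + 1\<close> also covers \<open>K = 0\<close>\<close>
    have "0 \<le> (- D / (K + 1)) * D + (- D / (K + 1))\<^sup>2 * K / 2"
      by (rule quadratic)
    also have "\<dots> = - (D\<^sup>2 * (K + 2)) / (2 * (K + 1)\<^sup>2)"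
    proof -
      have "K + 1 \<noteq> 0" using \<open>0 \<le> K\<close> by simp
      then show ?thesis by (simp add: divide_simps) (simp add: power2_eq_square algebra_simps)
    qed
    finally have nonneg: "0 \<le> - (D\<^sup>2 * (K + 2)) / (2 * (K + 1)\<^sup>2)" .
    have "0 < 2 * (K + 1)\<^sup>2" using \<open>0 \<le> K\<close> by simp
    from pos_le_divide_eq[OF this] nonneg have "D\<^sup>2 * (K + 2) \<le> 0"
      by (metis mult_zero_left neg_0_le_iff_le)
    then have "D = 0"
      using \<open>0 \<le> K\<close> by (auto simp: mult_le_0_iff)
    then show ?thesis by (simp add: D_def inner_commute)
  qed
  then show ?thesis by blast
qed

text \<open>The Banach-Steinhaus theorem. The open sets \<open>U n\<close> on which some \<open>T i\<close> exceeds \<open>n\<close> have empty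
  intersection, so by Baire one of them is not dense: on some ball all \<open>T i\<close> are bounded by \<open>n\<close>, and
  differences from its centre transfer this to a ball around the origin.\<close>

lemma uniform_boundedness:
  fixes T :: "'i \<Rightarrow> 'a::{real_normed_vector, complete_space} \<Rightarrow> 'b::real_normed_vector"
  assumes lin: "\<And>i. i \<in> I \<Longrightarrow> bounded_linear (T i)"
    and pointwise: "\<And>x. \<exists>B. \<forall>i\<in>I. norm (T i x) \<le> B"
  shows "\<exists>C\<ge>0. \<forall>i\<in>I. \<forall>x. norm (T i x) \<le> C * norm x"
proof -
  define U where "U n = (\<Union>i\<in>I. {x. real n < norm (T i x)})" for n :: nat
  have U_open: "open (U n)" for n
    unfolding U_def
    by (intro open_UN ballI open_Collect_less continuous_intros linear_continuous_on lin)
  have "\<exists>n. closure (U n) \<noteq> UNIV"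
  proof (rule ccontr)
    assume "\<not> ?thesis"
    then have "euclidean closure_of \<Inter>(range U) = topspace (euclidean :: 'a topology)"
      by (intro Baire_category) (auto simp: completely_metrizable_space_euclidean U_open)
    then obtain x where x: "\<And>n. x \<in> U n"
      by (cases "\<Inter>(range U) = {}") auto
    obtain B where B: "\<And>i. i \<in> I \<Longrightarrow> norm (T i x) \<le> B"
      using pointwise by blast
    obtain n where "B \<le> real n" using real_arch_simple by blast
    with x[of n] B show False by (force simp: U_def)
  qed
  then obtain n z where "z \<notin> closure (U n)" by auto
  then obtain r where "0 < r" and r: "\<And>x. dist x z < r \<Longrightarrow> x \<notin> U n"
    by (metis closure_approachable)
  have on_ball: "norm (T i x) \<le> real n" if "i \<in> I" "dist x z < r" for i x
    using r[OF that(2)] that(1) by (force simp: U_def)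
  have "norm (T i x) \<le> 4 * real n / r * norm x" if i: "i \<in> I" for i x
  proof (cases "x = 0")
    case True
    then show ?thesis
      using linear_0[OF bounded_linear.linear[OF lin[OF i]]] by simp
  next
    case False
    interpret Ti: bounded_linear "T i" using lin[OF i] .
    define s where "s = r / (2 * norm x)"
    have "0 < s" using False \<open>0 < r\<close> by (simp add: s_def)
    have "dist (z + s *\<^sub>R x) z < r"
      using False \<open>0 < r\<close> by (simp add: dist_norm s_def)
    then have "norm (T i (z + s *\<^sub>R x)) \<le> real n" "norm (T i z) \<le> real n"
      using on_ball[OF i] \<open>0 < r\<close> by auto
    moreover have "s *\<^sub>R T i x = T i (z + s *\<^sub>R x) - T i z"
      by (simp add: Ti.add Ti.scaleR)
    ultimately have "norm (s *\<^sub>R T i x) \<le> 2 * real n"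
      using norm_triangle_ineq4[of "T i (z + s *\<^sub>R x)" "T i z"] by simp
    then show ?thesis
      using \<open>0 < s\<close> \<open>0 < r\<close> False by (simp add: s_def field_simps)
  qed
  then show ?thesis
    using \<open>0 < r\<close> by (intro exI[of _ "4 * real n / r"]) auto
qed

lemma linear_of_adjoint:
  fixes T :: "'a::real_inner \<Rightarrow> 'b::real_inner"
  assumes "\<And>x y. inner (T x) y = inner x (S y)"
  shows "linear S"
proof
  show "S (x + y) = S x + S y" for x y
    by (rule vector_eq_ldot[THEN iffD1]) (simp add: assms[symmetric] inner_add_right)
  show "S (r *\<^sub>R x) = r *\<^sub>R S x" for r x
    by (rule vector_eq_ldot[THEN iffD1]) (simp add: assms[symmetric])
qed

text \<open>Douglas' range inclusion theorem. If the range of \<open>T\<close> lies in that of \<open>X\<close>, then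
  \<open>inner (T x) f\<close> equals \<open>inner y (X' f)\<close> for a vector \<open>y\<close> depending on \<open>x\<close> only, hence is bounded
  on the set where \<open>norm (X' f) \<le> 1\<close>; uniform boundedness makes the bound independent of \<open>x\<close>.
  Conversely, the inequality lets \<open>inner (T' f) x\<close> be represented as \<open>inner (X' f) y\<close>, and this
  \<open>y\<close> solves \<open>X y = T x\<close>.\<close>

theorem douglas_range_inclusion:
  fixes T :: "'a::{real_inner, complete_space} \<Rightarrow> 'c::real_inner"
    and X :: "'b::{real_inner, complete_space} \<Rightarrow> 'c"
  assumes T: "bounded_linear T"
    and T_adj: "\<And>x y. inner (T x) y = inner x (T' y)"
    and X_adj: "\<And>x y. inner (X x) y = inner x (X' y)"
  shows "range T \<subseteq> range X \<longleftrightarrow> (\<exists>C\<ge>0. \<forall>f. norm (T' f) \<le> C * norm (X' f))"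
proof
  assume incl: "range T \<subseteq> range X"
  define F where "F = {f. norm (X' f) \<le> 1}"
  have "\<exists>C\<ge>0. \<forall>f\<in>F. \<forall>x. norm (inner (T x) f) \<le> C * norm x"
  proof (rule uniform_boundedness)
    show "bounded_linear (\<lambda>x. inner (T x) f)" for f
      by (rule bounded_linear_inner_left_comp[OF T])
    show "\<exists>B. \<forall>f\<in>F. norm (inner (T x) f) \<le> B" for x
    proof -
      obtain y where y: "T x = X y" using incl by blast
      have "norm (inner (T x) f) \<le> norm y" if "f \<in> F" for f
      proof -
        have "\<bar>inner y (X' f)\<bar> \<le> norm y * norm (X' f)" by (rule Cauchy_Schwarz_ineq2)
        also have "\<dots> \<le> norm y * 1" using that by (intro mult_left_mono) (auto simp: F_def)
        finally show ?thesis by (simp add: y X_adj)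
      qed
      then show ?thesis by blast
    qed
  qed
  then obtain C where "0 \<le> C" and C: "\<And>f x. f \<in> F \<Longrightarrow> \<bar>inner (T x) f\<bar> \<le> C * norm x"
    by auto
  have T'_bound: "norm (T' f) \<le> C" if "f \<in> F" for f
  proof (cases "T' f = 0")
    case False
    have "(norm (T' f))\<^sup>2 = inner (T (T' f)) f" by (simp add: T_adj power2_norm_eq_inner)
    also have "\<dots> \<le> C * norm (T' f)" using C[OF that, of "T' f"] by simp
    finally show ?thesis using False by (simp add: power2_eq_square)
  qed (use \<open>0 \<le> C\<close> in simp)
  interpret T': linear T' using T_adj by (rule linear_of_adjoint)
  interpret X': linear X' using X_adj by (rule linear_of_adjoint)
  have "norm (T' f) \<le> C * norm (X' f)" for f
  proof (cases "X' f = 0")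
    case True
    \<comment> \<open>all multiples of \<open>f\<close> lie in \<open>F\<close>\<close>
    have "norm (T' f) \<le> C / real (Suc n)" for n
    proof -
      have "norm (T' (real (Suc n) *\<^sub>R f)) \<le> C"
        by (rule T'_bound) (simp add: F_def X'.scaleR True del: of_nat_Suc)
      then have "real (Suc n) * norm (T' f) \<le> C" by (simp add: T'.scaleR del: of_nat_Suc)
      then show ?thesis by (simp add: pos_le_divide_eq mult.commute del: of_nat_Suc)
    qed
    moreover have "(\<lambda>n. C / real (Suc n)) \<longlonglongrightarrow> 0"
      by (rule LIMSEQ_Suc) (rule lim_const_over_n)
    ultimately have "norm (T' f) \<le> 0" by (intro LIMSEQ_le_const) auto
    then show ?thesis using True by simp
  next
    case False
    then show ?thesis
      using T'_bound[of "(1 / norm (X' f)) *\<^sub>R f"]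
      by (simp add: F_def T'.scaleR X'.scaleR field_simps)
  qed
  with \<open>0 \<le> C\<close> show "\<exists>C\<ge>0. \<forall>f. norm (T' f) \<le> C * norm (X' f)" by blast
next
  assume "\<exists>C\<ge>0. \<forall>f. norm (T' f) \<le> C * norm (X' f)"
  then obtain C where C: "\<And>f. norm (T' f) \<le> C * norm (X' f)" by blast
  have T': "linear T'" using T_adj by (rule linear_of_adjoint)
  have X': "linear X'" using X_adj by (rule linear_of_adjoint)
  show "range T \<subseteq> range X"
  proof
    fix v assume "v \<in> range T"
    then obtain x where x: "v = T x" by blast
    have "\<exists>y. \<forall>f. inner (T' f) x = inner (X' f) y"
    proof (rule riesz_along_linear_map[OF X'])
      show "linear (\<lambda>f. inner (T' f) x)"
        by (rule linearI) (simp_all add: linear_add[OF T'] linear_cmul[OF T'] inner_add_left)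
      show "\<bar>inner (T' f) x\<bar> \<le> (C * norm x) * norm (X' f)" for f
      proof -
        have "\<bar>inner (T' f) x\<bar> \<le> norm (T' f) * norm x" by (rule Cauchy_Schwarz_ineq2)
        also have "\<dots> \<le> C * norm (X' f) * norm x" by (intro mult_right_mono C) simp
        finally show ?thesis by (simp add: mult.commute mult.left_commute)
      qed
    qed
    then obtain y where y: "\<And>f. inner (T' f) x = inner (X' f) y" by blast
    have "T x = X y"
    proof (rule vector_eq_rdot[THEN iffD1], rule allI)
      show "inner (T x) f = inner (X y) f" for f
        using y[of f] T_adj[of x f] X_adj[of y f] by (simp only: inner_commute)
    qed
    then show "v \<in> range X" using x by blast
  qed
qed

section \<open>Completeness of the sequence space\<close>

lemma power2_norm_ell2:
  "(norm x)\<^sup>2 = (\<Sum>\<^sub>\<infinity>i. (cmod (Rep_ell2 x i))\<^sup>2)"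
proof -
  have s: "(\<lambda>i. (cmod (Rep_ell2 x i))\<^sup>2) summable_on UNIV" using Rep_ell2[of x] by simp
  have "(norm x)\<^sup>2 = Re (cinner x x)" by (simp add: power2_norm_eq_inner inner_eq_Re_cinner)
  also have "\<dots> = (\<Sum>\<^sub>\<infinity>i. Re (Rep_ell2 x i * cnj (Rep_ell2 x i)))"
    by (simp only: cinner_ell2.rep_eq infsum_Re ell2_summable_mult_cnj[OF s s])
  finally show ?thesis by (simp only: Re_mult_cnj_self)
qed

lemma Rep_ell2_minus: "Rep_ell2 (x - y) i = Rep_ell2 x i - Rep_ell2 y i"
  unfolding minus_ell2_def uminus_ell2_def plus_ell2.rep_eq scaleC_ell2.rep_eq by simp

lemma sum_le_power2_norm_ell2:
  assumes "finite F"
  shows "(\<Sum>i\<in>F. (cmod (Rep_ell2 x i))\<^sup>2) \<le> (norm x)\<^sup>2"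
  unfolding power2_norm_ell2
  by (rule finite_sum_le_infsum) (use Rep_ell2[of x] assms in auto)

lemma ell2_of_bounded_partial_sums:
  assumes "\<And>F. finite F \<Longrightarrow> (\<Sum>i\<in>F. (cmod (u i))\<^sup>2) \<le> B"
  shows "(\<lambda>i. (cmod (u i))\<^sup>2) summable_on UNIV" and "(norm (Abs_ell2 u))\<^sup>2 \<le> B"
proof -
  show s: "(\<lambda>i. (cmod (u i))\<^sup>2) summable_on UNIV"
    by (rule nonneg_bdd_above_summable_on) (use assms in \<open>auto intro!: bdd_aboveI2[where M = B]\<close>)
  then show "(norm (Abs_ell2 u))\<^sup>2 \<le> B"
    by (simp add: power2_norm_ell2 Abs_ell2_inverse infsum_le_finite_sums assms)
qed

text \<open>A Cauchy sequence converges in every coordinate. The distances to the coordinatewise limit are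
  controlled on finite sets of indices first, where the limit may be taken inside the sum; the bound
  does not depend on the finite set, so it carries over to the full sum.\<close>

instance ell2 :: (type) complete_space
proof
  fix X :: "nat \<Rightarrow> 'a ell2"
  assume "Cauchy X"
  have coord: "cmod (Rep_ell2 x i - Rep_ell2 y i) \<le> norm (x - y)" for x y :: "'a ell2" and i
    by (rule power2_le_imp_le)
      (use sum_le_power2_norm_ell2[of "{i}" "x - y"] in \<open>simp_all add: Rep_ell2_minus\<close>)
  have "Cauchy (\<lambda>n. Rep_ell2 (X n) i)" for i
  proof (rule CauchyI)
    fix \<epsilon> :: real assume "0 < \<epsilon>"
    from CauchyD[OF \<open>Cauchy X\<close> this]
    show "\<exists>M. \<forall>m\<ge>M. \<forall>n\<ge>M. norm (Rep_ell2 (X m) i - Rep_ell2 (X n) i) < \<epsilon>"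
      by (blast intro: le_less_trans[OF coord])
  qed
  then have "\<forall>i. \<exists>l. (\<lambda>n. Rep_ell2 (X n) i) \<longlonglongrightarrow> l"
    using Cauchy_convergent convergent_def by blast
  then obtain l where l: "\<And>i. (\<lambda>n. Rep_ell2 (X n) i) \<longlonglongrightarrow> l i" by metis
  have close: "\<exists>M. \<forall>n\<ge>M. norm (Abs_ell2 (\<lambda>i. Rep_ell2 (X n) i - l i)) \<le> \<epsilon> \<and>
      (\<lambda>i. (cmod (Rep_ell2 (X n) i - l i))\<^sup>2) summable_on UNIV" if "0 < \<epsilon>" for \<epsilon>
  proof -
    obtain M where M: "\<And>m n. m \<ge> M \<Longrightarrow> n \<ge> M \<Longrightarrow> norm (X m - X n) < \<epsilon>"
      using CauchyD[OF \<open>Cauchy X\<close> \<open>0 < \<epsilon>\<close>] by blast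
    have partial: "(\<Sum>i\<in>F. (cmod (Rep_ell2 (X n) i - l i))\<^sup>2) \<le> \<epsilon>\<^sup>2" if "finite F" "n \<ge> M" for n F
    proof (rule LIMSEQ_le_const2)
      show "(\<lambda>m. \<Sum>i\<in>F. (cmod (Rep_ell2 (X n) i - Rep_ell2 (X m) i))\<^sup>2)
          \<longlonglongrightarrow> (\<Sum>i\<in>F. (cmod (Rep_ell2 (X n) i - l i))\<^sup>2)"
        by (intro tendsto_intros l)
      have "(\<Sum>i\<in>F. (cmod (Rep_ell2 (X n) i - Rep_ell2 (X m) i))\<^sup>2) \<le> \<epsilon>\<^sup>2" if "m \<ge> M" for m
      proof -
        have "(\<Sum>i\<in>F. (cmod (Rep_ell2 (X n) i - Rep_ell2 (X m) i))\<^sup>2) \<le> (norm (X n - X m))\<^sup>2"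
          using sum_le_power2_norm_ell2[OF \<open>finite F\<close>, of "X n - X m"] by (simp add: Rep_ell2_minus)
        also have "\<dots> \<le> \<epsilon>\<^sup>2"
          using M[OF \<open>n \<ge> M\<close> that] by (intro power_mono) auto
        finally show ?thesis .
      qed
      then show "\<exists>N. \<forall>m\<ge>N. (\<Sum>i\<in>F. (cmod (Rep_ell2 (X n) i - Rep_ell2 (X m) i))\<^sup>2) \<le> \<epsilon>\<^sup>2"
        by blast
    qed
    show ?thesis
    proof (intro exI[of _ M] allI impI conjI)
      fix n assume "n \<ge> M"
      note * = ell2_of_bounded_partial_sums[where u = "\<lambda>i. Rep_ell2 (X n) i - l i", OF partial[OF _ \<open>n \<ge> M\<close>]]
      show "(\<lambda>i. (cmod (Rep_ell2 (X n) i - l i))\<^sup>2) summable_on UNIV" by (rule *(1))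
      show "norm (Abs_ell2 (\<lambda>i. Rep_ell2 (X n) i - l i)) \<le> \<epsilon>"
        by (rule power2_le_imp_le) (use *(2) \<open>0 < \<epsilon>\<close> in auto)
    qed
  qed
  have l_ell2: "(\<lambda>i. (cmod (l i))\<^sup>2) summable_on UNIV"
  proof -
    obtain n where "(\<lambda>i. (cmod (Rep_ell2 (X n) i - l i))\<^sup>2) summable_on UNIV"
      using close[OF zero_less_one] by blast
    then have "(\<lambda>i. (cmod (- 1 * (Rep_ell2 (X n) i - l i)))\<^sup>2) summable_on UNIV"
      by (rule ell2_summable_scale)
    from ell2_summable_add[OF this, of "Rep_ell2 (X n)"] show ?thesis
      using Rep_ell2[of "X n"] by simp
  qed
  have diff: "X n - Abs_ell2 l = Abs_ell2 (\<lambda>i. Rep_ell2 (X n) i - l i)" for n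
  proof -
    have "Rep_ell2 (X n - Abs_ell2 l) = (\<lambda>i. Rep_ell2 (X n) i - l i)"
      by (simp add: fun_eq_iff Rep_ell2_minus Abs_ell2_inverse l_ell2)
    then show ?thesis by (metis Rep_ell2_inverse)
  qed
  have "X \<longlonglongrightarrow> Abs_ell2 l"
  proof (rule LIMSEQ_I)
    fix \<epsilon> :: real assume "0 < \<epsilon>"
    then obtain M where M: "\<And>n. n \<ge> M \<Longrightarrow> norm (X n - Abs_ell2 l) \<le> \<epsilon> / 2"
      using close[of "\<epsilon> / 2"] by (auto simp: diff)
    show "\<exists>M. \<forall>n\<ge>M. norm (X n - Abs_ell2 l) < \<epsilon>"
    proof (intro exI allI impI)
      show "norm (X n - Abs_ell2 l) < \<epsilon>" if "n \<ge> M" for n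
        using M[OF that] \<open>0 < \<epsilon>\<close> by linarith
    qed
  qed
  then show "convergent X" by (rule convergentI)
qed

section \<open>Completeness of the space of square-integrable functions\<close>

lemma power2_norm_L2:
  assumes "square_integrable f"
  shows "(norm (abs_L2 f))\<^sup>2 = (\<integral>t. (cmod (f t))\<^sup>2 \<partial>lborel)"
proof -
  have "L2_rel f f" using assms by (simp add: L2_rel_def)
  then have "cinner (abs_L2 f) (abs_L2 f) = (\<integral>t. f t * cnj (f t) \<partial>lborel)"
    by (simp add: cinner_L2.abs_eq)
  then have "(norm (abs_L2 f))\<^sup>2 = Re (\<integral>t. f t * cnj (f t) \<partial>lborel)"
    by (simp add: power2_norm_eq_inner inner_eq_Re_cinner)
  then show ?thesis
    using assms by (simp only: square_integrable_mult_cnj Re_mult_cnj_self integral_Re[symmetric])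
qed

lemma nn_integral_eq_norm_L2:
  assumes "square_integrable f"
  shows "(\<integral>\<^sup>+t. ennreal ((cmod (f t))\<^sup>2) \<partial>lborel) = ennreal ((norm (abs_L2 f))\<^sup>2)"
  using assms by (simp add: power2_norm_L2 nn_integral_eq_integral square_integrable_def)

lemma square_integrable_diff:
  assumes "square_integrable f" "square_integrable g"
  shows "square_integrable (\<lambda>t. f t - g t)"
  using square_integrable_add[OF assms(1) square_integrable_mult[OF assms(2), of "\<lambda>_. - 1" 1]]
  by simp

lemma abs_L2_diff:
  assumes "square_integrable f" "square_integrable g"
  shows "abs_L2 f - abs_L2 g = abs_L2 (\<lambda>t. f t - g t)"
proof -
  have "square_integrable (\<lambda>t. - g t)"
    using square_integrable_mult[OF assms(2), of "\<lambda>_. - 1" 1] by simp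
  with assms have rel: "L2_rel f f" "L2_rel g g" "L2_rel (\<lambda>t. - g t) (\<lambda>t. - g t)"
    by (simp_all add: L2_rel_def)
  have "abs_L2 f - abs_L2 g = abs_L2 f + (- 1) *\<^sub>C abs_L2 g"
    by (simp only: minus_L2_def uminus_L2_def)
  also have "\<dots> = abs_L2 f + abs_L2 (\<lambda>t. - g t)"
    by (simp only: scaleC_L2.abs_eq[OF rel(2)] mult_minus1)
  also have "\<dots> = abs_L2 (\<lambda>t. f t - g t)"
    by (simp add: plus_L2.abs_eq[OF rel(1,3)])
  finally show ?thesis .
qed

lemma L2_representative: "\<exists>f. square_integrable f \<and> x = abs_L2 f"
proof -
  have "L2_rel (rep_L2 x) (rep_L2 x)" by (simp add: Quotient_rep_reflp[OF Quotient_L2])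
  then show ?thesis
    by (intro exI[of _ "rep_L2 x"]) (auto simp: L2_rel_def Quotient_abs_rep[OF Quotient_L2])
qed

text \<open>The Riesz-Fischer argument: geometric decay makes the sequence of representatives converge
  almost everywhere, and Fatou's lemma shows that the pointwise limit is the limit in norm. Almost
  everywhere convergence comes from summing the squared increments with weights \<open>2 ^ n\<close>, which keeps
  the integral finite and dominates the increments themselves through
  \<open>u \<le> (1/2) ^ n + 2 ^ n * u\<^sup>2\<close>.\<close>

lemma L2_fast_Cauchy_convergent:
  fixes X :: "nat \<Rightarrow> L2"
  assumes fast: "\<And>m n. n \<le> m \<Longrightarrow> norm (X m - X n) \<le> (1/2) ^ n"
  shows "convergent X"
proof -
  obtain f where f: "\<And>n. square_integrable (f n)" and X: "\<And>n. X n = abs_L2 (f n)"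
    using L2_representative[of "X n" for n] by metis
  note [measurable] = f[THEN square_integrable_measurable]
  have dist_f: "(\<integral>\<^sup>+t. ennreal ((cmod (f m t - f n t))\<^sup>2) \<partial>lborel) \<le> ennreal ((1/4) ^ n)"
    if "n \<le> m" for m n
  proof -
    have "(norm (X m - X n))\<^sup>2 \<le> ((1/2) ^ n)\<^sup>2"
      by (intro power_mono fast that) simp
    also have "\<dots> = (1/4) ^ n" by (simp add: power2_eq_square power_mult_distrib[symmetric])
    finally show ?thesis
      using nn_integral_eq_norm_L2[OF square_integrable_diff[OF f[of m] f[of n]]]
      by (simp add: X abs_L2_diff f ennreal_leI)
  qed
  define h where "h n t = 2 ^ n * (cmod (f (Suc n) t - f n t))\<^sup>2" for n t
  have h_int: "(\<integral>\<^sup>+t. ennreal (h n t) \<partial>lborel) \<le> ennreal ((1/2) ^ n)" for n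
  proof -
    have "(\<integral>\<^sup>+t. ennreal (h n t) \<partial>lborel)
        = ennreal (2 ^ n) * (\<integral>\<^sup>+t. ennreal ((cmod (f (Suc n) t - f n t))\<^sup>2) \<partial>lborel)"
      unfolding h_def by (subst nn_integral_cmult[symmetric]) (auto simp: ennreal_mult)
    also have "\<dots> \<le> ennreal (2 ^ n) * ennreal ((1/4) ^ n)"
      by (intro mult_left_mono dist_f) auto
    also have "\<dots> = ennreal ((1/2) ^ n)"
      by (simp add: ennreal_mult[symmetric] power_mult_distrib[symmetric])
    finally show ?thesis .
  qed
  have "(\<integral>\<^sup>+t. (\<Sum>n. ennreal (h n t)) \<partial>lborel) \<noteq> \<infinity>"
  proof -
    have "(\<integral>\<^sup>+t. (\<Sum>n. ennreal (h n t)) \<partial>lborel) = (\<Sum>n. \<integral>\<^sup>+t. ennreal (h n t) \<partial>lborel)"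
      unfolding h_def by (rule nn_integral_suminf) measurable
    also have "\<dots> \<le> (\<Sum>n. ennreal ((1/2) ^ n))"
      by (intro suminf_le h_int) auto
    also have "\<dots> = ennreal (\<Sum>n. (1/2) ^ n)"
      by (intro suminf_ennreal2 summable_geometric) auto
    finally show ?thesis by (auto simp: top_unique)
  qed
  then have "AE t in lborel. (\<Sum>n. ennreal (h n t)) \<noteq> \<infinity>"
    unfolding h_def by (intro nn_integral_PInf_AE) measurable
  then have AE_conv: "AE t in lborel. (\<lambda>n. f n t) \<longlonglongrightarrow> lim (\<lambda>n. f n t)"
  proof eventually_elim
    case (elim t)
    then have "summable (\<lambda>n. h n t)"
      by (intro summable_suminf_not_top) (auto simp: h_def)
    then have "summable (\<lambda>n. (1/2) ^ n + h n t)"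
      by (intro summable_add summable_geometric) auto
    moreover have "norm (f (Suc n) t - f n t) \<le> (1/2) ^ n + h n t" for n
    proof -
      define u where "u = cmod (f (Suc n) t - f n t)"
      have "0 \<le> (1 - 2 ^ n * u)\<^sup>2" and "0 \<le> u" by (simp_all add: u_def)
      then have "2 * (2 ^ n * u) \<le> 1 + (2 ^ n * u)\<^sup>2" by (simp add: power2_diff)
      moreover have "0 \<le> 2 ^ n * u" using \<open>0 \<le> u\<close> by simp
      ultimately have "2 ^ n * u \<le> 1 + (2 ^ n * u)\<^sup>2" by linarith
      then show ?thesis
        by (simp add: h_def u_def[symmetric] field_simps power2_eq_square power_divide)
    qed
    ultimately have "summable (\<lambda>n. f (Suc n) t - f n t)"
      by (rule summable_comparison_test'[where N = 0])
    then have "(\<lambda>n. f 0 t + (\<Sum>k<n. f (Suc k) t - f k t))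
        \<longlonglongrightarrow> f 0 t + (\<Sum>k. f (Suc k) t - f k t)"
      by (intro tendsto_intros summable_LIMSEQ)
    moreover have "f 0 t + (\<Sum>k<n. f (Suc k) t - f k t) = f n t" for n
      using sum_lessThan_telescope[of "\<lambda>k. f k t" n] by simp
    ultimately have "(\<lambda>n. f n t) \<longlonglongrightarrow> f 0 t + (\<Sum>k. f (Suc k) t - f k t)"
      by simp
    then have "convergent (\<lambda>n. f n t)" by (rule convergentI)
    then show ?case by (simp add: convergent_LIMSEQ_iff)
  qed
  define g where "g t = lim (\<lambda>n. f n t)" for t
  have [measurable]: "g \<in> borel_measurable borel" unfolding g_def by measurable
  have g_near: "(\<integral>\<^sup>+t. ennreal ((cmod (g t - f n t))\<^sup>2) \<partial>lborel) \<le> ennreal ((1/4) ^ n)" for n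
  proof -
    have "AE t in lborel. ennreal ((cmod (g t - f n t))\<^sup>2)
        = liminf (\<lambda>m. ennreal ((cmod (f m t - f n t))\<^sup>2))"
      using AE_conv
    proof eventually_elim
      case (elim t)
      then have "(\<lambda>m. ennreal ((cmod (f m t - f n t))\<^sup>2)) \<longlonglongrightarrow> ennreal ((cmod (g t - f n t))\<^sup>2)"
        by (intro tendsto_intros) (simp add: g_def)
      from lim_imp_Liminf[OF _ this] show ?case by simp
    qed
    then have "(\<integral>\<^sup>+t. ennreal ((cmod (g t - f n t))\<^sup>2) \<partial>lborel)
        = (\<integral>\<^sup>+t. liminf (\<lambda>m. ennreal ((cmod (f m t - f n t))\<^sup>2)) \<partial>lborel)"
      by (rule nn_integral_cong_AE)
    also have "\<dots> \<le> liminf (\<lambda>m. \<integral>\<^sup>+t. ennreal ((cmod (f m t - f n t))\<^sup>2) \<partial>lborel)"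
      by (rule nn_integral_liminf) measurable
    also have "\<dots> \<le> liminf (\<lambda>m. ennreal ((1/4) ^ n))"
      by (intro Liminf_mono eventually_sequentiallyI[of n] dist_f)
    finally show ?thesis by (simp add: Liminf_const)
  qed
  have diff: "square_integrable (\<lambda>t. g t - f n t)" for n
    unfolding square_integrable_def
  proof
    show "integrable lborel (\<lambda>t. (cmod (g t - f n t))\<^sup>2)"
      using g_near[of n] by (intro integrableI_nonneg) (auto intro: le_less_trans)
  qed measurable
  have g: "square_integrable g"
    using square_integrable_add[OF diff[of 0] f[of 0]] by simp
  have "norm (X n - abs_L2 g) \<le> (1/2) ^ n" for n
  proof (rule power2_le_imp_le)
    have "ennreal ((norm (abs_L2 g - X n))\<^sup>2) \<le> ennreal ((1/4) ^ n)"
      using g_near[of n] nn_integral_eq_norm_L2[OF diff[of n]] by (simp add: X abs_L2_diff f g)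
    then have "(norm (abs_L2 g - X n))\<^sup>2 \<le> (1/4) ^ n" by simp
    also have "(1/4 :: real) ^ n = ((1/2) ^ n)\<^sup>2" by (simp add: power2_eq_square power_mult_distrib[symmetric])
    finally show "(norm (X n - abs_L2 g))\<^sup>2 \<le> ((1/2) ^ n)\<^sup>2" by (simp add: norm_minus_commute)
  qed simp
  moreover have "(\<lambda>n. (1/2 :: real) ^ n) \<longlonglongrightarrow> 0" by (rule LIMSEQ_realpow_zero) auto
  ultimately have "(\<lambda>n. X n - abs_L2 g) \<longlonglongrightarrow> 0"
    by (rule Lim_null_comparison[OF always_eventually, OF allI])
  then have "X \<longlonglongrightarrow> abs_L2 g" by (simp add: LIM_zero_iff)
  then show ?thesis by (rule convergentI)
qed

instance L2 :: complete_space
proof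
  fix X :: "nat \<Rightarrow> L2"
  assume "Cauchy X"
  have "\<exists>N. \<forall>p\<ge>N. \<forall>q\<ge>N. norm (X p - X q) < (1/2) ^ n" for n
    by (rule CauchyD[OF \<open>Cauchy X\<close>]) simp
  then obtain N where N: "\<And>n p q. p \<ge> N n \<Longrightarrow> q \<ge> N n \<Longrightarrow> norm (X p - X q) < (1/2) ^ n"
    by metis
  \<comment> \<open>partial sums of \<open>N\<close> dominate all earlier thresholds at once\<close>
  define r where "r n = (\<Sum>i\<le>n. N i)" for n
  have r: "N n \<le> r m" if "n \<le> m" for m n
    unfolding r_def using that by (intro member_le_sum) auto
  have "convergent (\<lambda>n. X (r n))"
    by (rule L2_fast_Cauchy_convergent) (use N r in \<open>auto intro!: less_imp_le\<close>)
  then obtain x where x: "(\<lambda>n. X (r n)) \<longlonglongrightarrow> x" by (auto simp: convergent_def)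
  have "X \<longlonglongrightarrow> x"
  proof (rule LIMSEQ_I)
    fix \<epsilon> :: real assume "0 < \<epsilon>"
    obtain n0 where n0: "\<And>n. n \<ge> n0 \<Longrightarrow> norm (X (r n) - x) < \<epsilon> / 2"
      using LIMSEQ_D[OF x, of "\<epsilon> / 2"] \<open>0 < \<epsilon>\<close> by auto
    obtain n1 where n1: "(1/2) ^ n1 < \<epsilon> / 2"
      using real_arch_pow_inv[of "\<epsilon> / 2" "1/2"] \<open>0 < \<epsilon>\<close> by auto
    define n where "n = max n0 n1"
    have "norm (X p - x) < \<epsilon>" if "p \<ge> N n1" for p
    proof -
      have "norm (X p - X (r n)) < \<epsilon> / 2"
        using N[OF that r[of n1 n]] n1 by (simp add: n_def)
      moreover have "norm (X (r n) - x) < \<epsilon> / 2" by (rule n0) (simp add: n_def)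
      ultimately show ?thesis
        using norm_triangle_ineq[of "X p - X (r n)" "X (r n) - x"] by simp
    qed
    then show "\<exists>no. \<forall>n\<ge>no. norm (X n - x) < \<epsilon>" by blast
  qed
  then show "convergent X" by (rule convergentI)
qed

section \<open>Adjoints of bounded complex-linear operators\<close>

lemma scaleR_as_scaleC: "r *\<^sub>R x = complex_of_real r *\<^sub>C x" for x :: "'a::complex_inner"
  by (simp add: scaleC_of_real)

lemma cinner_scaleC_right: "cinner x (z *\<^sub>C y) = cnj z * cinner x y"
  by (metis cinner_commute cinner_scaleC_left complex_cnj_mult)

lemma cinner_add_right: "cinner x (y + u) = cinner x y + cinner x u"
  by (metis cinner_commute cinner_add_left complex_cnj_add)

lemma cinner_diff_left: "cinner (x - y) u = cinner x u - cinner y u"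
  using cinner_add_left[of "x - y" y u] by simp

lemma cinner_self: "cinner x x = complex_of_real ((norm x)\<^sup>2)"
proof (rule complex_eqI)
  show "Re (cinner x x) = Re (complex_of_real ((norm x)\<^sup>2))"
    by (simp add: power2_norm_eq_inner inner_eq_Re_cinner)
  have "Im (cinner x x) = - Im (cinner x x)"
    using arg_cong[OF cinner_commute[of x x], of Im] by simp
  then show "Im (cinner x x) = Im (complex_of_real ((norm x)\<^sup>2))" by simp
qed

lemma inner_scaleC_left: "inner (z *\<^sub>C x) y = inner x (cnj z *\<^sub>C y)"
  by (simp add: inner_eq_Re_cinner cinner_scaleC_left cinner_scaleC_right)

lemma cinner_eq_via_inner: "cinner x y = Complex (inner x y) (inner x (\<i> *\<^sub>C y))"
  by (simp add: complex_eq_iff inner_eq_Re_cinner cinner_scaleC_right)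

lemma bounded_clinearI:
  assumes "\<And>x y. T (x + y) = T x + T y" and "\<And>z x. T (z *\<^sub>C x) = z *\<^sub>C T x"
    and "\<And>x. norm (T x) \<le> norm x * K"
  shows "bounded_clinear T"
  unfolding bounded_clinear_def
proof
  show "Vector_Spaces.linear scaleC scaleC T"
    by (simp add: Vector_Spaces.linear_iff assms complex_vector.vector_space_axioms)
  show "bounded_linear T"
    by (rule bounded_linear_intro[of T K]) (simp_all add: assms scaleR_as_scaleC)
qed

lemma bounded_clinearD:
  assumes "bounded_clinear T"
  shows "bounded_linear T" "T (x + y) = T x + T y" "T (z *\<^sub>C x) = z *\<^sub>C T x"
  using assms by (auto simp: bounded_clinear_def Vector_Spaces.linear_iff)

lemma bounded_clinear_compose:
  assumes "bounded_clinear S" "bounded_clinear T"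
  shows "bounded_clinear (\<lambda>x. S (T x))"
  using assms bounded_linear_compose[of S T]
  by (auto simp: bounded_clinear_def Vector_Spaces.linear_iff)

text \<open>The Riesz lemma yields a vector representing the real part of \<open>cinner (T x) y\<close>;
  complex linearity of \<open>T\<close> recovers the imaginary part from the real one.\<close>

lemma cadjoint_works:
  fixes T :: "'a::{complex_inner, complete_space} \<Rightarrow> 'b::complex_inner"
  assumes T: "bounded_clinear T"
  shows "cinner (T x) y = cinner x (cadjoint T y)"
proof -
  note bl = bounded_clinearD(1)[OF T]
  have "\<exists>S. \<forall>x. inner (T x) y = inner x S" for y
  proof (rule riesz_along_linear_map[of "\<lambda>x. x"])
    show "linear (\<lambda>x. inner (T x) y)"
      by (rule bounded_linear.linear[OF bounded_linear_inner_left_comp[OF bl]])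
    show "\<bar>inner (T x) y\<bar> \<le> (onorm T * norm y) * norm x" for x
    proof -
      have "\<bar>inner (T x) y\<bar> \<le> norm (T x) * norm y" by (rule Cauchy_Schwarz_ineq2)
      also have "\<dots> \<le> onorm T * norm x * norm y" by (intro mult_right_mono onorm bl) simp
      finally show ?thesis by (simp add: mult.commute mult.left_commute)
    qed
  qed (rule linear_ident)
  then obtain S where S: "\<And>x y. inner (T x) y = inner x (S y)" by metis
  have "inner (T x) (\<i> *\<^sub>C y) = inner x (\<i> *\<^sub>C S y)" for x y
    using inner_scaleC_left[of "- \<i>" "T x" y] inner_scaleC_left[of "- \<i>" x "S y"]
    by (simp flip: bounded_clinearD(3)[OF T] add: S)
  then have "\<forall>x y. cinner (T x) y = cinner x (S y)"
    by (simp add: cinner_eq_via_inner S)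
  then have "\<forall>x y. cinner (T x) y = cinner x (cadjoint T y)"
    unfolding cadjoint_def
    by (rule someI[of "\<lambda>S. \<forall>x y. cinner (T x) y = cinner x (S y)"])
  then show ?thesis by blast
qed

lemma cadjoint_works_inner:
  fixes T :: "'a::{complex_inner, complete_space} \<Rightarrow> 'b::complex_inner"
  assumes "bounded_clinear T"
  shows "inner (T x) y = inner x (cadjoint T y)"
  by (simp add: inner_eq_Re_cinner cadjoint_works[OF assms])

lemma cinner_eq_rdotI:
  assumes "\<And>x. cinner x y = cinner x (u :: 'a::complex_inner)"
  shows "y = u"
proof (rule vector_eq_ldot[THEN iffD1], rule allI)
  show "inner x y = inner x u" for x by (simp add: inner_eq_Re_cinner assms)
qed

lemma bounded_clinear_cadjoint:
  fixes T :: "'a::{complex_inner, complete_space} \<Rightarrow> 'b::complex_inner"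
  assumes T: "bounded_clinear T"
  shows "bounded_clinear (cadjoint T)"
proof (rule bounded_clinearI)
  note adj = cadjoint_works[OF T, symmetric]
  show "cadjoint T (x + y) = cadjoint T x + cadjoint T y" for x y
    by (rule cinner_eq_rdotI) (simp add: adj cinner_add_right)
  show "cadjoint T (z *\<^sub>C x) = z *\<^sub>C cadjoint T x" for z x
    by (rule cinner_eq_rdotI) (simp add: adj cinner_scaleC_right)
  show "norm (cadjoint T y) \<le> norm y * onorm T" for y
  proof (cases "cadjoint T y = 0")
    case False
    have "norm (cadjoint T y) * norm (cadjoint T y) = inner (T (cadjoint T y)) y"
      by (simp add: cadjoint_works_inner[OF T] norm_eq_sqrt_inner)
    also have "\<dots> \<le> norm (T (cadjoint T y)) * norm y" by (rule norm_cauchy_schwarz)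
    also have "\<dots> \<le> onorm T * norm (cadjoint T y) * norm y"
      by (intro mult_right_mono onorm bounded_clinearD(1)[OF T]) simp
    finally show ?thesis using False by (simp add: mult.commute mult.left_commute)
  qed (simp add: onorm_pos_le bounded_clinearD(1)[OF T])
qed

text \<open>Moving both adjoints to the other side turns the order relation between operators into a
  comparison of norms, the form in which it meets the upper frame bound.\<close>

lemma relatively_hyponormal_iff:
  fixes \<Theta> :: "'a::{complex_inner, complete_space} \<Rightarrow> 'a"
    and \<Xi> :: "'c::{complex_inner, complete_space} \<Rightarrow> 'a"
  assumes \<Theta>: "bounded_clinear \<Theta>" and \<Xi>: "bounded_clinear \<Xi>"
  shows "relatively_hyponormal \<Theta> \<Xi> \<longleftrightarrow>
    (\<exists>l>0. \<forall>f. (norm (cadjoint \<Xi> f))\<^sup>2 \<le> l * (norm (\<Theta> f))\<^sup>2)"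
proof -
  have "cinner (l *\<^sub>R cadjoint \<Theta> (\<Theta> f) - \<Xi> (cadjoint \<Xi> f)) f
      = complex_of_real (l * (norm (\<Theta> f))\<^sup>2 - (norm (cadjoint \<Xi> f))\<^sup>2)" for l f
  proof -
    have "cinner (cadjoint \<Theta> (\<Theta> f)) f = cinner (\<Theta> f) (\<Theta> f)"
      by (metis cadjoint_works[OF \<Theta>] cinner_commute)
    moreover have "cinner (\<Xi> (cadjoint \<Xi> f)) f = cinner (cadjoint \<Xi> f) (cadjoint \<Xi> f)"
      by (rule cadjoint_works[OF \<Xi>])
    ultimately show ?thesis
      by (simp add: cinner_diff_left scaleR_as_scaleC cinner_scaleC_left cinner_self)
  qed
  then show ?thesis
    unfolding relatively_hyponormal_def op_ge_def
    by (simp add: complex_nonneg_Reals_iff)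
qed

section \<open>Coefficient maps and Parseval's identity\<close>

text \<open>For a Bessel family \<open>g\<close> this is the analysis operator of frame theory.\<close>

definition coefficients :: "('i \<Rightarrow> 'a::complex_inner) \<Rightarrow> 'a \<Rightarrow> 'i ell2" where
  "coefficients g f = Abs_ell2 (\<lambda>i. cinner f (g i))"

lemma Rep_coefficients:
  assumes "(\<lambda>i. (cmod (cinner f (g i)))\<^sup>2) summable_on UNIV"
  shows "Rep_ell2 (coefficients g f) i = cinner f (g i)"
  using assms by (simp add: coefficients_def Abs_ell2_inverse)

lemma power2_norm_coefficients:
  assumes "(\<lambda>i. (cmod (cinner f (g i)))\<^sup>2) summable_on UNIV"
  shows "(norm (coefficients g f))\<^sup>2 = (\<Sum>\<^sub>\<infinity>i. (cmod (cinner f (g i)))\<^sup>2)"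
  by (simp add: power2_norm_ell2 Rep_coefficients[OF assms])

lemma ell2_eqI: "(\<And>i. Rep_ell2 x i = Rep_ell2 y i) \<Longrightarrow> x = y"
  by (metis Rep_ell2_inject ext)

lemma bounded_clinear_coefficients:
  assumes summable: "\<And>f. (\<lambda>i. (cmod (cinner f (g i)))\<^sup>2) summable_on UNIV"
    and bound: "\<And>f. (\<Sum>\<^sub>\<infinity>i. (cmod (cinner f (g i)))\<^sup>2) \<le> B * (norm f)\<^sup>2"
  shows "bounded_clinear (coefficients g)"
proof (rule bounded_clinearI)
  note Rep = Rep_coefficients[of _ g, OF summable]
  show "coefficients g (x + y) = coefficients g x + coefficients g y" for x y
    by (rule ell2_eqI) (simp add: Rep plus_ell2.rep_eq cinner_add_left)
  show "coefficients g (z *\<^sub>C x) = z *\<^sub>C coefficients g x" for z x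
    by (rule ell2_eqI) (simp add: Rep scaleC_ell2.rep_eq cinner_scaleC_left)
  show "norm (coefficients g f) \<le> norm f * sqrt \<bar>B\<bar>" for f
  proof (rule power2_le_imp_le)
    have "(norm (coefficients g f))\<^sup>2 \<le> B * (norm f)\<^sup>2"
      unfolding power2_norm_coefficients[OF summable] by (rule bound)
    also have "\<dots> \<le> \<bar>B\<bar> * (norm f)\<^sup>2" by (intro mult_right_mono) auto
    finally show "(norm (coefficients g f))\<^sup>2 \<le> (norm f * sqrt \<bar>B\<bar>)\<^sup>2"
      by (simp add: power_mult_distrib mult.commute)
  qed simp
qed

lift_definition unit_ell2 :: "'i \<Rightarrow> 'i ell2" is "\<lambda>i j. if j = i then 1 else 0"
proof -
  fix i :: 'i
  have "(\<lambda>j. (cmod (if j = i then 1 else 0))\<^sup>2) summable_on {i}" by (rule summable_on_finite) simp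
  then show "(\<lambda>j. (cmod (if j = i then 1 else 0))\<^sup>2) summable_on UNIV"
    by (rule summable_on_cong_neutral[THEN iffD1, rotated 3]) auto
qed

lemma cinner_unit_ell2: "cinner x (unit_ell2 i) = Rep_ell2 x i"
proof -
  have "cinner x (unit_ell2 i) = (\<Sum>\<^sub>\<infinity>j. Rep_ell2 x j * cnj (if j = i then 1 else 0))"
    by (simp add: cinner_ell2.rep_eq unit_ell2.rep_eq)
  also have "\<dots> = (\<Sum>\<^sub>\<infinity>j\<in>{i}. Rep_ell2 x j)"
    by (rule infsum_cong_neutral) auto
  finally show ?thesis by simp
qed

lemma cinner_sum_left: "cinner (\<Sum>i\<in>F. h i) y = (\<Sum>i\<in>F. cinner (h i) y)"
proof (induction F rule: infinite_finite_induct)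
  have "cinner 0 y = 0" using cinner_scaleC_left[of 0 y y] by simp
  then show "cinner (sum h {}) y = (\<Sum>i\<in>{}. cinner (h i) y)"
    and "infinite F \<Longrightarrow> cinner (sum h F) y = (\<Sum>i\<in>F. cinner (h i) y)" for F
    by simp_all
qed (simp add: cinner_add_left)

lemma bessel_inequality:
  assumes ortho: "\<And>i j. cinner (e i) (e j) = (if i = j then 1 else 0)" and F: "finite F"
  shows "(\<Sum>i\<in>F. (cmod (cinner y (e i)))\<^sup>2) \<le> (norm y)\<^sup>2"
proof -
  define s where "s = (\<Sum>i\<in>F. cinner y (e i) *\<^sub>C e i)"
  define S where "S = (\<Sum>i\<in>F. (cmod (cinner y (e i)))\<^sup>2)"
  have s_left: "cinner s u = (\<Sum>i\<in>F. cinner y (e i) * cinner (e i) u)" for u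
    by (simp add: s_def cinner_sum_left cinner_scaleC_left)
  have "cinner s (e j) = cinner y (e j)" if "j \<in> F" for j
    unfolding s_left using F that by (simp add: ortho if_distrib[of "(*) _"] sum.delta cong: if_cong)
  then have "cinner (e j) s = cnj (cinner y (e j))" if "j \<in> F" for j
    using that by (metis cinner_commute)
  then have "cinner s s = (\<Sum>i\<in>F. cinner y (e i) * cnj (cinner y (e i)))"
    unfolding s_left by (intro sum.cong) auto
  then have ss: "inner s s = S" 
    by (simp only: inner_eq_Re_cinner Re_sum Re_mult_cnj_self S_def)
  have "cinner s y = (\<Sum>i\<in>F. cinner y (e i) * cnj (cinner y (e i)))"
    unfolding s_left by (intro sum.cong) (auto simp: cinner_commute[of "e _" y])
  then have sy: "inner s y = S"
    by (simp only: inner_eq_Re_cinner Re_sum Re_mult_cnj_self S_def)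
  have "0 \<le> inner (y - s) (y - s)" by simp
  also have "\<dots> = (norm y)\<^sup>2 - S"
    using ss sy by (simp add: inner_diff inner_commute power2_norm_eq_inner)
  finally show ?thesis by (simp add: S_def)
qed

text \<open>The coefficients are finite by Bessel's inequality. The vectors \<open>y\<close> on which the coefficient map
  preserves all inner products \<open>inner y z\<close> form a closed complex subspace containing the basis, hence
  the whole space. Testing against every \<open>z\<close>, instead of asking for equality of norms, is what makes
  this set a subspace.\<close>

lemma parseval:
  assumes e: "is_orthonormal_basis e"
  shows "(\<lambda>i. (cmod (cinner y (e i)))\<^sup>2) summable_on UNIV" (is "?summable y")
    and "(norm (coefficients e y))\<^sup>2 = (norm y)\<^sup>2" (is "?isometric y")
    and "bounded_clinear (coefficients e)"
proof -
  have ortho: "\<And>i j. cinner (e i) (e j) = (if i = j then 1 else 0)"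
    and dense: "closure (complex_vector.span (range e)) = UNIV"
    using e by (auto simp: is_orthonormal_basis_def)
  note partial = bessel_inequality[OF ortho]
  have summable: "?summable y" for y
    using ell2_of_bounded_partial_sums(1)[OF partial] .
  then show "?summable y" .
  show bcl: "bounded_clinear (coefficients e)"
    by (rule bounded_clinear_coefficients[where B = 1]) (simp_all add: summable infsum_le_finite_sums partial)
  define V where "V = {y. \<forall>z. inner (coefficients e y) (coefficients e z) = inner y z}"
  have "range e \<subseteq> V"
  proof clarify
    fix i
    have "coefficients e (e i) = unit_ell2 i"
      by (rule ell2_eqI) (simp add: Rep_coefficients[OF summable] unit_ell2.rep_eq ortho)
    moreover have "inner (coefficients e z) (unit_ell2 i) = inner z (e i)" for z
      by (simp add: inner_eq_Re_cinner cinner_unit_ell2 Rep_coefficients[OF summable])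
    ultimately show "e i \<in> V" by (simp add: V_def inner_commute)
  qed
  moreover have "complex_vector.subspace V"
  proof (rule complex_vector.subspaceI)
    show "0 \<in> V" using bounded_clinearD(3)[OF bcl, of 0 0] by (simp add: V_def)
    show "x + y \<in> V" if "x \<in> V" "y \<in> V" for x y
      using that by (simp add: V_def bounded_clinearD(2)[OF bcl] inner_add_left)
    show "z *\<^sub>C x \<in> V" if "x \<in> V" for z x
    proof -
      have "inner (coefficients e (z *\<^sub>C x)) (coefficients e w)
          = inner (coefficients e x) (coefficients e (cnj z *\<^sub>C w))" for w
        by (simp add: bounded_clinearD(3)[OF bcl] inner_scaleC_left)
      then show ?thesis using that by (simp add: V_def inner_scaleC_left)
    qed
  qed
  ultimately have "complex_vector.span (range e) \<subseteq> V" by (rule complex_vector.span_minimal)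
  moreover have "closed V"
    unfolding V_def
    by (intro closed_Collect_all closed_Collect_eq continuous_intros linear_continuous_on
        bounded_clinearD(1)[OF bcl])
  ultimately have "y \<in> V" using dense closure_minimal by blast
  then show "?isometric y" by (simp add: V_def power2_norm_eq_inner)
qed

text \<open>The adjoint of the analysis operator of \<open>g\<close> sends the unit sequences to the members of \<open>g\<close>;
  composing it with the coefficient map of \<open>e\<close> replaces the unit sequences by the given basis.\<close>

lemma synthesis_operator:
  fixes g :: "'i \<Rightarrow> 'a::{complex_inner, complete_space}" and e :: "'i \<Rightarrow> 'k::complex_inner"
  assumes e: "is_orthonormal_basis e"
    and "\<And>f. (\<lambda>i. (cmod (cinner f (g i)))\<^sup>2) summable_on UNIV"
    and "\<And>f. (\<Sum>\<^sub>\<infinity>i. (cmod (cinner f (g i)))\<^sup>2) \<le> B * (norm f)\<^sup>2"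
  shows "\<exists>\<Xi>. bounded_clinear \<Xi> \<and> (\<forall>i. \<Xi> (e i) = g i)"
proof (intro exI conjI allI)
  have bcl: "bounded_clinear (coefficients g)" by (rule bounded_clinear_coefficients) fact+
  show "bounded_clinear (\<lambda>y. cadjoint (coefficients g) (coefficients e y))"
    by (rule bounded_clinear_compose[OF bounded_clinear_cadjoint[OF bcl] parseval(3)[OF e]])
  fix i
  have "coefficients e (e i) = unit_ell2 i"
    using e by (intro ell2_eqI)
      (simp add: Rep_coefficients[OF parseval(1)[OF e]] unit_ell2.rep_eq is_orthonormal_basis_def)
  then show "cadjoint (coefficients g) (coefficients e (e i)) = g i"
    by (intro cinner_eq_rdotI)
      (simp add: cadjoint_works[OF bcl, symmetric] cinner_unit_ell2 Rep_coefficients assms(2))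
qed

text \<open>The frame coefficient \<open>cinner f (g i)\<close> is the \<open>i\<close>-th coordinate of \<open>cadjoint \<Xi> f\<close> with respect to
  the basis \<open>e\<close>, so Parseval evaluates the frame sum.\<close>

lemma frame_sum_eq_norm_cadjoint:
  fixes \<Xi> :: "'k::{complex_inner, complete_space} \<Rightarrow> 'a::complex_inner"
  assumes e: "is_orthonormal_basis e" and \<Xi>: "bounded_clinear \<Xi>" and g: "\<And>i. \<Xi> (e i) = g i"
  shows "(\<lambda>i. (cmod (cinner f (g i)))\<^sup>2) summable_on UNIV"
    and "(\<Sum>\<^sub>\<infinity>i. (cmod (cinner f (g i)))\<^sup>2) = (norm (cadjoint \<Xi> f))\<^sup>2"
proof -
  have eq: "cmod (cinner f (g i)) = cmod (cinner (cadjoint \<Xi> f) (e i))" for i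
    by (metis cadjoint_works[OF \<Xi>] cinner_commute complex_mod_cnj g)
  show "(\<lambda>i. (cmod (cinner f (g i)))\<^sup>2) summable_on UNIV"
    unfolding eq by (rule parseval(1)[OF e])
  show "(\<Sum>\<^sub>\<infinity>i. (cmod (cinner f (g i)))\<^sup>2) = (norm (cadjoint \<Xi> f))\<^sup>2"
    unfolding eq power2_norm_coefficients[OF parseval(1)[OF e], symmetric] by (rule parseval(2)[OF e])
qed

section \<open>Frames relative to an operator\<close>

text \<open>Once the frame sum is \<open>norm (cadjoint \<Xi> f)\<^sup>2\<close>, the upper frame bound reads as relative
  hyponormality and the lower one as Douglas' inequality between \<open>cadjoint \<Theta>\<close> and
  \<open>cadjoint \<Xi>\<close>.\<close>

theorem Theta_frame_iff_synthesis_operator: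
  fixes g :: "'i \<Rightarrow> 'a::{complex_inner, complete_space}"
    and e :: "'i \<Rightarrow> 'k::{complex_inner, complete_space}"
  assumes \<Theta>: "bounded_clinear \<Theta>" and e: "is_orthonormal_basis e"
  shows "(\<exists>\<alpha> \<beta>. 0 < \<alpha> \<and> \<alpha> \<le> \<beta> \<and>
       (\<forall>f. (\<lambda>i. (cmod (cinner f (g i)))\<^sup>2) summable_on UNIV \<and>
            \<alpha> * (norm (cadjoint \<Theta> f))\<^sup>2 \<le> (\<Sum>\<^sub>\<infinity>i. (cmod (cinner f (g i)))\<^sup>2) \<and>
            (\<Sum>\<^sub>\<infinity>i. (cmod (cinner f (g i)))\<^sup>2) \<le> \<beta> * (norm (\<Theta> f))\<^sup>2)) \<longleftrightarrow>
    (\<exists>\<Xi>. bounded_clinear \<Xi> \<and> relatively_hyponormal \<Theta> \<Xi> \<and>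
       (\<forall>i. \<Xi> (e i) = g i) \<and> range \<Theta> \<subseteq> range \<Xi>)" (is "?frame \<longleftrightarrow> ?op")
proof
  note bl = bounded_clinearD(1)[OF \<Theta>]
  assume ?frame
  then obtain \<alpha> \<beta> where \<alpha>: "0 < \<alpha>" and \<beta>: "\<alpha> \<le> \<beta>"
    and summable: "\<And>f. (\<lambda>i. (cmod (cinner f (g i)))\<^sup>2) summable_on UNIV"
    and lower: "\<And>f. \<alpha> * (norm (cadjoint \<Theta> f))\<^sup>2 \<le> (\<Sum>\<^sub>\<infinity>i. (cmod (cinner f (g i)))\<^sup>2)"
    and upper: "\<And>f. (\<Sum>\<^sub>\<infinity>i. (cmod (cinner f (g i)))\<^sup>2) \<le> \<beta> * (norm (\<Theta> f))\<^sup>2"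
    by blast
  have "(\<Sum>\<^sub>\<infinity>i. (cmod (cinner f (g i)))\<^sup>2) \<le> (\<beta> * (onorm \<Theta>)\<^sup>2) * (norm f)\<^sup>2" for f
  proof -
    have "\<beta> * (norm (\<Theta> f))\<^sup>2 \<le> \<beta> * (onorm \<Theta> * norm f)\<^sup>2"
      using \<alpha> \<beta> by (intro mult_left_mono power_mono onorm bl) auto
    with upper[of f] show ?thesis by (simp add: power_mult_distrib mult.assoc)
  qed
  from synthesis_operator[OF e summable this] obtain \<Xi> :: "'k \<Rightarrow> 'a"
    where \<Xi>: "bounded_clinear \<Xi>" and g: "\<And>i. \<Xi> (e i) = g i" by blast
  note sum_eq = frame_sum_eq_norm_cadjoint(2)[OF e \<Xi> g]
  have "relatively_hyponormal \<Theta> \<Xi>"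
    unfolding relatively_hyponormal_iff[OF \<Theta> \<Xi>]
    using upper \<alpha> \<beta> by (intro exI[of _ \<beta>]) (auto simp: sum_eq)
  moreover have "norm (cadjoint \<Theta> f) \<le> sqrt (1 / \<alpha>) * norm (cadjoint \<Xi> f)" for f
  proof (rule power2_le_imp_le)
    show "(norm (cadjoint \<Theta> f))\<^sup>2 \<le> (sqrt (1 / \<alpha>) * norm (cadjoint \<Xi> f))\<^sup>2"
      using lower[of f] \<alpha> by (simp add: sum_eq power_mult_distrib field_simps)
  qed (use \<alpha> in simp)
  then have "\<exists>C\<ge>0. \<forall>f. norm (cadjoint \<Theta> f) \<le> C * norm (cadjoint \<Xi> f)"
    using \<alpha> by (intro exI[of _ "sqrt (1 / \<alpha>)"]) auto
  then have "range \<Theta> \<subseteq> range \<Xi>"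
    by (rule douglas_range_inclusion[OF bl cadjoint_works_inner[OF \<Theta>] cadjoint_works_inner[OF \<Xi>], THEN iffD2])
  ultimately show ?op using \<Xi> g by blast
next
  assume ?op
  then obtain \<Xi> where \<Xi>: "bounded_clinear \<Xi>" and hypo: "relatively_hyponormal \<Theta> \<Xi>"
    and g: "\<And>i. \<Xi> (e i) = g i" and incl: "range \<Theta> \<subseteq> range \<Xi>" by blast
  note sum_eq = frame_sum_eq_norm_cadjoint(2)[OF e \<Xi> g]
  obtain l where "0 < l" and l: "\<And>f. (norm (cadjoint \<Xi> f))\<^sup>2 \<le> l * (norm (\<Theta> f))\<^sup>2"
    using hypo unfolding relatively_hyponormal_iff[OF \<Theta> \<Xi>] by blast
  obtain C where "0 \<le> C" and C: "\<And>f. norm (cadjoint \<Theta> f) \<le> C * norm (cadjoint \<Xi> f)"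
    using douglas_range_inclusion[OF bounded_clinearD(1)[OF \<Theta>] cadjoint_works_inner[OF \<Theta>]
        cadjoint_works_inner[OF \<Xi>]] incl by blast
  \<comment> \<open>the minimum enforces \<open>\<alpha> \<le> \<beta>\<close> with \<open>\<beta> = l\<close>; the summand \<open>1\<close> covers \<open>C = 0\<close>\<close>
  define \<alpha> where "\<alpha> = min l (1 / (C\<^sup>2 + 1))"
  have "0 < C\<^sup>2 + 1" by (simp add: add_nonneg_pos)
  then have "0 < \<alpha>" using \<open>0 < l\<close> by (simp add: \<alpha>_def)
  have "\<alpha> * (norm (cadjoint \<Theta> f))\<^sup>2 \<le> (norm (cadjoint \<Xi> f))\<^sup>2" for f
  proof -
    have "(norm (cadjoint \<Theta> f))\<^sup>2 \<le> (C * norm (cadjoint \<Xi> f))\<^sup>2"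
      by (intro power_mono C) simp
    also have "\<dots> \<le> (C\<^sup>2 + 1) * (norm (cadjoint \<Xi> f))\<^sup>2"
      by (simp add: power_mult_distrib algebra_simps)
    finally have "\<alpha> * (norm (cadjoint \<Theta> f))\<^sup>2 \<le> \<alpha> * ((C\<^sup>2 + 1) * (norm (cadjoint \<Xi> f))\<^sup>2)"
      using \<open>0 < \<alpha>\<close> by (intro mult_left_mono) auto
    also have "\<dots> \<le> 1 / (C\<^sup>2 + 1) * ((C\<^sup>2 + 1) * (norm (cadjoint \<Xi> f))\<^sup>2)"
      by (intro mult_right_mono) (auto simp: \<alpha>_def)
    also have "\<dots> = (norm (cadjoint \<Xi> f))\<^sup>2"
      using \<open>0 < C\<^sup>2 + 1\<close> by simp
    finally show ?thesis .
  qed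
  then show ?frame
    using \<open>0 < \<alpha>\<close> l frame_sum_eq_norm_cadjoint(1)[OF e \<Xi> g]
    by (intro exI[of _ \<alpha>] exI[of _ l]) (simp add: sum_eq \<alpha>_def)
qed

theorem theorem3p6:
  fixes \<psi> :: L2 and a c :: "int \<Rightarrow> real" and b :: real and \<Theta> :: "L2 \<Rightarrow> L2"
    and e :: "int \<times> int \<times> int \<Rightarrow> (int \<times> int \<times> int) ell2"
  assumes "\<And>j. a j > 0"
    and "b \<noteq> 0"
    and "bounded_clinear \<Theta>"
    and "is_orthonormal_basis e"
  shows "Theta_IWH_frame \<Theta> a b c \<psi> \<longleftrightarrow>
    (\<exists>\<Xi> :: (int \<times> int \<times> int) ell2 \<Rightarrow> L2.
       bounded_clinear \<Xi> \<and>
       relatively_hyponormal \<Theta> \<Xi> \<and>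
       (\<forall>j k m. \<Xi> (e (j, k, m)) = wave_packet a b c \<psi> (j, k, m)) \<and>
       range \<Theta> \<subseteq> range \<Xi>)"
  unfolding Theta_IWH_frame_def
  using Theta_frame_iff_synthesis_operator[OF assms(3,4), of "wave_packet a b c \<psi>"]
  by (simp add: split_paired_all)

end
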